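(* Let $G$ be an orbifold groupoid over $G_0$. Then there exists a faithful unitary representation of the groupoid $G$ on a continuous family of finite dimensional Hilbert spaces over $G_0$.
   Context: Groupoids. A Lie groupoid $G$ over $G_0$ is a groupoid with space of arrows $G$ and space of objects $G_0$, both smooth manifolds ($G_0$ Hausdorff and second countable), such that all structure maps (source $s$, target $t$, multiplication, inverse, unit) are smooth and $s,t$ are submersions with Hausdorff fibers. Write $G(x,y)=s^{-1}(x)\cap t^{-1}(y)$ for the arrows from $x$ to $y$ and $G_x=G(x,x)$ for the isotropy group. $G$ is étale if $s$ and $t$ are local diffeomorphisms; $G$ is proper if the space of arrows $G$ is Hausdorff and $(s,t):G\to G_0\times G_0$ is a proper continuous map. An orbifold groupoid is a proper étale Lie groupoid. Continuous families of Hilbert spaces. Let $B$ be a locally compact Hausdorff space. A continuous family of (complex) Hilbert spaces over $B$ is a pair $(\{E_x\}_{x\in B},\Gamma)$, where each $E_x$ is a Hilbert space and $\Gamma\subset\prod_{x\in B}E_x$ is a vector subspace such that: (1) for each $x\in B$ and $v\in E_x$ there is $s\in\Gamma$ with $s(x)=v$; (2) for all $s_1,s_2\in\Gamma$ the function $x\mapsto\langle s_1(x),s_2(x)\rangle_x$ is continuous on $B$; (3) if $w\in\prod_{x\in B}E_x$ is such that for each $x\in B$ and each $\epsilon>0$ there are a neighbourhood $U$ of $x$ and $s\in\Gamma$ with $\|s(x')-w(x')\|_{x'}<\epsilon$ for all $x'\in U$, then $w\in\Gamma$. It is a continuous family of finite dimensional Hilbert spaces if all $E_x$ are finite dimensional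 (the dimension may vary with $x$). The total space $E=\coprod_{x\in B}E_x$, with projection $p:E\to B$, carries the topology with basis the tubular sets $B(V,s,\epsilon)=\{v\in E : p(v)\in V,\ \|s(p(v))-v\|_{p(v)}<\epsilon\}$, for $V\subset B$ open, $s\in\Gamma$, $\epsilon>0$. The family is denoted simply by $E$. Representations. A (continuous) representation of $G$ on a continuous family $p:E\to G_0$ of Hilbert spaces over $G_0$ is a continuous left action of $G$ on the space $E$ along $p$ (i.e. a continuous map $G\times_{G_0}^{s,p}E\to E$, $(g,v)\mapsto g\cdot v$, with $p(g\cdot v)=t(g)$, $1_{p(v)}\cdot v=v$, $g'\cdot(g\cdot v)=(g'g)\cdot v$) such that each $g\in G(x,y)$ acts as a linear isomorphism $E_x\to E_y$. It is unitary if each $g\in G$ acts as a unitary map. It is faithful if for each $x\in G_0$ the isotropy group $G_x$ acts faithfully on $E_x$. *)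

theory Defs
  imports "HOL-Analysis.Analysis" "HOL-Algebra.Module"
begin

section \<open>Smooth manifolds\<close>

text \<open>
  The model space of an \<open>n\<close>-dimensional manifold is \<^term>\<open>Euclidean_space n\<close>, i.e. the real sequences
  vanishing from index \<open>n\<close> on. In this way the dimension is a natural number and may be \<open>0\<close>, which a
  type of class \<open>euclidean_space\<close> would exclude.

  \<open>C_on n k U f\<close>: the real function \<open>f\<close> is of class \<open>C\<^sup>k\<close> on the open set \<open>U\<close> of the model space,
  i.e. it is continuous and all its iterated partial derivatives up to order \<open>k\<close> exist and are
  continuous on \<open>U\<close>.
\<close>

primrec C_on :: "nat \<Rightarrow> nat \<Rightarrow> (nat \<Rightarrow> real) set \<Rightarrow> ((nat \<Rightarrow> real) \<Rightarrow> real) \<Rightarrow> bool" where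
  "C_on n 0 U f \<longleftrightarrow> continuous_map (subtopology (Euclidean_space n) U) euclideanreal f"
| "C_on n (Suc k) U f \<longleftrightarrow>
     continuous_map (subtopology (Euclidean_space n) U) euclideanreal f \<and>
     (\<forall>i<n. \<exists>f'. (\<forall>x\<in>U. ((\<lambda>t. f (x(i := t))) has_real_derivative f' x) (at (x i))) \<and> C_on n k U f')"

definition smooth_Euclidean ::
    "nat \<Rightarrow> nat \<Rightarrow> (nat \<Rightarrow> real) set \<Rightarrow> ((nat \<Rightarrow> real) \<Rightarrow> nat \<Rightarrow> real) \<Rightarrow> bool" where
  "smooth_Euclidean m n U F \<longleftrightarrow> (\<forall>j<n. \<forall>k. C_on m k U (\<lambda>x. F x j))"

text \<open>A chart is a pair \<open>(U, \<phi>)\<close>; the values of \<open>\<phi>\<close> outside \<open>U\<close> are irrelevant.\<close>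

record 'a manifold =
  mtop :: "'a topology"
  mdim :: nat
  matlas :: "('a set \<times> ('a \<Rightarrow> nat \<Rightarrow> real)) set"

definition is_chart :: "'a topology \<Rightarrow> nat \<Rightarrow> 'a set \<Rightarrow> ('a \<Rightarrow> nat \<Rightarrow> real) \<Rightarrow> bool" where
  "is_chart X n U \<phi> \<longleftrightarrow>
     openin X U \<and> openin (Euclidean_space n) (\<phi> ` U) \<and>
     homeomorphic_map (subtopology X U) (subtopology (Euclidean_space n) (\<phi> ` U)) \<phi>"

text \<open>Neither the Hausdorff property nor second countability is part of the definition.\<close>

definition smooth_manifold :: "'a manifold \<Rightarrow> bool" where
  "smooth_manifold M \<longleftrightarrow>
     (\<forall>(U, \<phi>) \<in> matlas M. is_chart (mtop M) (mdim M) U \<phi>) \<and>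
     (\<Union>(U, \<phi>) \<in> matlas M. U) = topspace (mtop M) \<and>
     (\<forall>(U, \<phi>) \<in> matlas M. \<forall>(V, \<psi>) \<in> matlas M.
        smooth_Euclidean (mdim M) (mdim M) (\<phi> ` (U \<inter> V)) (\<psi> \<circ> inv_into U \<phi>))"

definition smooth_map :: "'a manifold \<Rightarrow> 'b manifold \<Rightarrow> ('a \<Rightarrow> 'b) \<Rightarrow> bool" where
  "smooth_map M N f \<longleftrightarrow>
     continuous_map (mtop M) (mtop N) f \<and>
     (\<forall>(U, \<phi>) \<in> matlas M. \<forall>(V, \<psi>) \<in> matlas N.
        smooth_Euclidean (mdim M) (mdim N) (\<phi> ` (U \<inter> f -` V)) (\<psi> \<circ> f \<circ> inv_into U \<phi>))"

definition open_submanifold :: "'a manifold \<Rightarrow> 'a set \<Rightarrow> 'a manifold" where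
  "open_submanifold M W =
     \<lparr>mtop = subtopology (mtop M) W, mdim = mdim M, matlas = (\<lambda>(U, \<phi>). (U \<inter> W, \<phi>)) ` matlas M\<rparr>"

definition prod_manifold :: "'a manifold \<Rightarrow> 'b manifold \<Rightarrow> ('a \<times> 'b) manifold" where
  "prod_manifold M N =
     \<lparr>mtop = prod_topology (mtop M) (mtop N), mdim = mdim M + mdim N,
      matlas = (\<lambda>((U, \<phi>), (V, \<psi>)).
        (U \<times> V, \<lambda>(p, q) i. if i < mdim M then \<phi> p i else \<psi> q (i - mdim M)))
        ` (matlas M \<times> matlas N)\<rparr>"

text \<open>
  Smoothness on a subset \<open>S\<close> of a manifold: local extendability to smooth maps on open subsets. If \<open>S\<close>
  is an embedded submanifold, this is smoothness for the submanifold structure of \<open>S\<close>.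
\<close>

definition smooth_map_on :: "'a manifold \<Rightarrow> 'a set \<Rightarrow> 'b manifold \<Rightarrow> ('a \<Rightarrow> 'b) \<Rightarrow> bool" where
  "smooth_map_on M S N f \<longleftrightarrow>
     (\<forall>p\<in>S. \<exists>W F. openin (mtop M) W \<and> p \<in> W \<and>
        smooth_map (open_submanifold M W) N F \<and> (\<forall>x \<in> S \<inter> W. F x = f x))"

text \<open>The differential, expressed by the Jacobian matrix \<open>J\<close> in charts, is surjective at every point.\<close>

definition submersion :: "'a manifold \<Rightarrow> 'b manifold \<Rightarrow> ('a \<Rightarrow> 'b) \<Rightarrow> bool" where
  "submersion M N f \<longleftrightarrow>
     smooth_map M N f \<and>
     (\<forall>(U, \<phi>) \<in> matlas M. \<forall>(V, \<psi>) \<in> matlas N. \<forall>p \<in> U \<inter> f -` V.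
        let J = (\<lambda>j i. deriv (\<lambda>t. (\<psi> \<circ> f \<circ> inv_into U \<phi>) ((\<phi> p)(i := t)) j) (\<phi> p i))
        in \<forall>v :: nat \<Rightarrow> real. \<exists>w :: nat \<Rightarrow> real. \<forall>j < mdim N. v j = (\<Sum>i < mdim M. J j i * w i))"

definition diffeomorphism :: "'a manifold \<Rightarrow> 'b manifold \<Rightarrow> ('a \<Rightarrow> 'b) \<Rightarrow> bool" where
  "diffeomorphism M N f \<longleftrightarrow>
     smooth_map M N f \<and> bij_betw f (topspace (mtop M)) (topspace (mtop N)) \<and>
     smooth_map N M (inv_into (topspace (mtop M)) f)"

definition local_diffeomorphism :: "'a manifold \<Rightarrow> 'b manifold \<Rightarrow> ('a \<Rightarrow> 'b) \<Rightarrow> bool" where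
  "local_diffeomorphism M N f \<longleftrightarrow>
     (\<forall>p \<in> topspace (mtop M). \<exists>U. openin (mtop M) U \<and> p \<in> U \<and> openin (mtop N) (f ` U) \<and>
        diffeomorphism (open_submanifold M U) (open_submanifold N (f ` U)) f)"


section \<open>Lie groupoids\<close>

text \<open>The product \<open>gcomp G h g\<close> is meaningful if \<open>gsrc G h = gtgt G g\<close>, i.e. \<open>g\<close> is applied first.\<close>

record ('o, 'a) groupoid_data =
  Obj :: "'o manifold"
  Arr :: "'a manifold"
  gsrc :: "'a \<Rightarrow> 'o"
  gtgt :: "'a \<Rightarrow> 'o"
  gcomp :: "'a \<Rightarrow> 'a \<Rightarrow> 'a"
  ginv :: "'a \<Rightarrow> 'a"
  gunit :: "'o \<Rightarrow> 'a"

definition objects :: "('o, 'a) groupoid_data \<Rightarrow> 'o set" where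
  "objects G = topspace (mtop (Obj G))"

definition arrows :: "('o, 'a) groupoid_data \<Rightarrow> 'a set" where
  "arrows G = topspace (mtop (Arr G))"

definition hom_arrows :: "('o, 'a) groupoid_data \<Rightarrow> 'o \<Rightarrow> 'o \<Rightarrow> 'a set" where
  "hom_arrows G x y = {g \<in> arrows G. gsrc G g = x \<and> gtgt G g = y}"

definition composable :: "('o, 'a) groupoid_data \<Rightarrow> ('a \<times> 'a) set" where
  "composable G = {(h, g). h \<in> arrows G \<and> g \<in> arrows G \<and> gsrc G h = gtgt G g}"

locale groupoid =
  fixes G :: "('o, 'a) groupoid_data"
  assumes src_closed: "g \<in> arrows G \<Longrightarrow> gsrc G g \<in> objects G"
    and tgt_closed: "g \<in> arrows G \<Longrightarrow> gtgt G g \<in> objects G"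
    and comp_closed: "(h, g) \<in> composable G \<Longrightarrow> gcomp G h g \<in> hom_arrows G (gsrc G g) (gtgt G h)"
    and unit_closed: "x \<in> objects G \<Longrightarrow> gunit G x \<in> hom_arrows G x x"
    and inv_closed: "g \<in> arrows G \<Longrightarrow> ginv G g \<in> hom_arrows G (gtgt G g) (gsrc G g)"
    and comp_assoc: "\<lbrakk>(k, h) \<in> composable G; (h, g) \<in> composable G\<rbrakk>
          \<Longrightarrow> gcomp G (gcomp G k h) g = gcomp G k (gcomp G h g)"
    and comp_unit_left: "g \<in> arrows G \<Longrightarrow> gcomp G (gunit G (gtgt G g)) g = g"
    and comp_unit_right: "g \<in> arrows G \<Longrightarrow> gcomp G g (gunit G (gsrc G g)) = g"
    and comp_inv_left: "g \<in> arrows G \<Longrightarrow> gcomp G (ginv G g) g = gunit G (gsrc G g)"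
    and comp_inv_right: "g \<in> arrows G \<Longrightarrow> gcomp G g (ginv G g) = gunit G (gtgt G g)"

locale Lie_groupoid = groupoid G for G :: "('o, 'a) groupoid_data" +
  assumes manifold_Obj: "smooth_manifold (Obj G)"
    and Hausdorff_Obj: "Hausdorff_space (mtop (Obj G))"
    and second_countable_Obj: "second_countable (mtop (Obj G))"
    and manifold_Arr: "smooth_manifold (Arr G)"
    and submersion_src: "submersion (Arr G) (Obj G) (gsrc G)"
    and submersion_tgt: "submersion (Arr G) (Obj G) (gtgt G)"
    and Hausdorff_src_fibre:
      "x \<in> objects G \<Longrightarrow> Hausdorff_space (subtopology (mtop (Arr G)) {g \<in> arrows G. gsrc G g = x})"
    and Hausdorff_tgt_fibre:
      "x \<in> objects G \<Longrightarrow> Hausdorff_space (subtopology (mtop (Arr G)) {g \<in> arrows G. gtgt G g = x})"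
    and smooth_comp:
      "smooth_map_on (prod_manifold (Arr G) (Arr G)) (composable G) (Arr G) (\<lambda>(h, g). gcomp G h g)"
    and smooth_inv: "smooth_map (Arr G) (Arr G) (ginv G)"
    and smooth_unit: "smooth_map (Obj G) (Arr G) (gunit G)"

locale etale_groupoid = Lie_groupoid G for G :: "('o, 'a) groupoid_data" +
  assumes local_diffeo_src: "local_diffeomorphism (Arr G) (Obj G) (gsrc G)"
    and local_diffeo_tgt: "local_diffeomorphism (Arr G) (Obj G) (gtgt G)"

text \<open>
  \<^const>\<open>proper_map\<close> means closed with compact fibres. Since the target is locally compact and
  Hausdorff, for continuous maps this says that preimages of compact sets are compact.
\<close>

locale proper_groupoid = Lie_groupoid G for G :: "('o, 'a) groupoid_data" +
  assumes Hausdorff_Arr: "Hausdorff_space (mtop (Arr G))"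
    and continuous_anchor: "continuous_map (mtop (Arr G))
          (prod_topology (mtop (Obj G)) (mtop (Obj G))) (\<lambda>g. (gsrc G g, gtgt G g))"
    and proper_anchor: "proper_map (mtop (Arr G))
          (prod_topology (mtop (Obj G)) (mtop (Obj G))) (\<lambda>g. (gsrc G g, gtgt G g))"

locale orbifold_groupoid = proper_groupoid G + etale_groupoid G
  for G :: "('o, 'a) groupoid_data"


section \<open>Continuous families of Hilbert spaces\<close>

text \<open>
  A vector space is a module (in the sense of \<^theory>\<open>HOL-Algebra.Module\<close>) over the field of complex
  numbers. As in that theory, the multiplicative monoid part of the record is not used for vectors.
\<close>

definition complex_field :: "complex ring" where
  "complex_field = \<lparr>carrier = UNIV, monoid.mult = (*), one = 1, ring.zero = 0, add = (+)\<rparr>"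

record 'v hilbert = "(complex, 'v) module" +
  hinner :: "'v \<Rightarrow> 'v \<Rightarrow> complex"

definition hnorm :: "'v hilbert \<Rightarrow> 'v \<Rightarrow> real" where
  "hnorm H v = sqrt (Re (hinner H v v))"

locale hilbert_space = Module.module complex_field H for H :: "'v hilbert" (structure) +
  assumes inner_add_left: "\<lbrakk>u \<in> carrier H; v \<in> carrier H; w \<in> carrier H\<rbrakk>
        \<Longrightarrow> hinner H (u \<oplus> v) w = hinner H u w + hinner H v w"
    and inner_smult_left: "\<lbrakk>v \<in> carrier H; w \<in> carrier H\<rbrakk>
        \<Longrightarrow> hinner H (c \<odot> v) w = c * hinner H v w"
    and inner_cnj: "\<lbrakk>v \<in> carrier H; w \<in> carrier H\<rbrakk> \<Longrightarrow> hinner H w v = cnj (hinner H v w)"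
    and inner_pos: "\<lbrakk>v \<in> carrier H; v \<noteq> \<zero>\<rbrakk> \<Longrightarrow> 0 < Re (hinner H v v)"
    and complete: "Metric_space.mcomplete (carrier H) (\<lambda>u v. hnorm H (u \<ominus> v))"

definition finite_dimensional :: "'v hilbert \<Rightarrow> bool" where
  "finite_dimensional H \<longleftrightarrow>
     (\<exists>B. finite B \<and> B \<subseteq> carrier H \<and>
        (\<forall>v \<in> carrier H. \<exists>c :: 'v \<Rightarrow> complex. v = (\<Oplus>\<^bsub>H\<^esub>b\<in>B. c b \<odot>\<^bsub>H\<^esub> b)))"

text \<open>
  Elements of the product of the fibres are represented by extensional functions, i.e. functions equal
  to \<^term>\<open>undefined\<close> outside of the base space.
\<close>

locale continuous_hilbert_family =
  fixes B :: "'b topology" and E :: "'b \<Rightarrow> 'v hilbert" and \<Gamma> :: "('b \<Rightarrow> 'v) set"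
  assumes locally_compact_base: "locally_compact_space B"
    and Hausdorff_base: "Hausdorff_space B"
    and hilbert_fibre: "x \<in> topspace B \<Longrightarrow> hilbert_space (E x)"
    and sections: "\<Gamma> \<subseteq> (\<Pi>\<^sub>E x\<in>topspace B. carrier (E x))"
    and sections_zero: "(\<lambda>x\<in>topspace B. \<zero>\<^bsub>E x\<^esub>) \<in> \<Gamma>"
    and sections_add: "\<lbrakk>s \<in> \<Gamma>; s' \<in> \<Gamma>\<rbrakk> \<Longrightarrow> (\<lambda>x\<in>topspace B. s x \<oplus>\<^bsub>E x\<^esub> s' x) \<in> \<Gamma>"
    and sections_smult: "s \<in> \<Gamma> \<Longrightarrow> (\<lambda>x\<in>topspace B. c \<odot>\<^bsub>E x\<^esub> s x) \<in> \<Gamma>"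
    and sections_through: "\<lbrakk>x \<in> topspace B; v \<in> carrier (E x)\<rbrakk> \<Longrightarrow> \<exists>s\<in>\<Gamma>. s x = v"
    and sections_inner: "\<lbrakk>s \<in> \<Gamma>; s' \<in> \<Gamma>\<rbrakk>
        \<Longrightarrow> continuous_map B euclidean (\<lambda>x. hinner (E x) (s x) (s' x))"
    and sections_local: "\<lbrakk>w \<in> (\<Pi>\<^sub>E x\<in>topspace B. carrier (E x));
          \<And>x \<epsilon>. \<lbrakk>x \<in> topspace B; \<epsilon> > 0\<rbrakk> \<Longrightarrow>
            \<exists>U s. openin B U \<and> x \<in> U \<and> s \<in> \<Gamma> \<and> (\<forall>x'\<in>U. hnorm (E x') (s x' \<ominus>\<^bsub>E x'\<^esub> w x') < \<epsilon>)\<rbrakk>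
        \<Longrightarrow> w \<in> \<Gamma>"

locale continuous_fd_hilbert_family = continuous_hilbert_family B E \<Gamma>
  for B :: "'b topology" and E :: "'b \<Rightarrow> 'v hilbert" and \<Gamma> :: "('b \<Rightarrow> 'v) set" +
  assumes fd_fibre: "x \<in> topspace B \<Longrightarrow> finite_dimensional (E x)"

text \<open>
  The total space is the disjoint union of the fibres, with projection \<^const>\<open>fst\<close>. The tubular sets
  form a basis, so the topology generated by them is the one with this basis.

  The type \<open>'v\<close> is only a universe for the carriers of the fibres. For finite-dimensional fibres,
  \<open>nat \<Rightarrow> complex\<close> is large enough: every such Hilbert space is isomorphic to one with carrier in this
  type, and families, sections and actions can be transported along fibrewise isomorphisms.
\<close>

definition tube ::
    "('b \<Rightarrow> 'v hilbert) \<Rightarrow> 'b set \<Rightarrow> ('b \<Rightarrow> 'v) \<Rightarrow> real \<Rightarrow> ('b \<times> 'v) set" where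
  "tube E V s \<epsilon> = {(x, v). x \<in> V \<and> v \<in> carrier (E x) \<and> hnorm (E x) (s x \<ominus>\<^bsub>E x\<^esub> v) < \<epsilon>}"

definition total_topology ::
    "'b topology \<Rightarrow> ('b \<Rightarrow> 'v hilbert) \<Rightarrow> ('b \<Rightarrow> 'v) set \<Rightarrow> ('b \<times> 'v) topology" where
  "total_topology B E \<Gamma> =
     topology_generated_by {tube E V s \<epsilon> | V s \<epsilon>. openin B V \<and> s \<in> \<Gamma> \<and> \<epsilon> > 0}"


section \<open>Representations\<close>

definition linear_iso :: "'v hilbert \<Rightarrow> 'w hilbert \<Rightarrow> ('v \<Rightarrow> 'w) \<Rightarrow> bool" where
  "linear_iso H K T \<longleftrightarrow>
     bij_betw T (carrier H) (carrier K) \<and>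
     (\<forall>u \<in> carrier H. \<forall>v \<in> carrier H. T (u \<oplus>\<^bsub>H\<^esub> v) = T u \<oplus>\<^bsub>K\<^esub> T v) \<and>
     (\<forall>c. \<forall>v \<in> carrier H. T (c \<odot>\<^bsub>H\<^esub> v) = c \<odot>\<^bsub>K\<^esub> T v)"

definition unitary_map :: "'v hilbert \<Rightarrow> 'w hilbert \<Rightarrow> ('v \<Rightarrow> 'w) \<Rightarrow> bool" where
  "unitary_map H K T \<longleftrightarrow>
     linear_iso H K T \<and>
     (\<forall>u \<in> carrier H. \<forall>v \<in> carrier H. hinner K (T u) (T v) = hinner H u v)"

text \<open>The map \<open>E\<^sub>x \<rightarrow> E\<^sub>y\<close> by which an arrow \<open>g\<close> from \<open>x\<close> to \<open>y\<close> acts.\<close>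

definition fibre_map ::
    "('o, 'a) groupoid_data \<Rightarrow> ('a \<Rightarrow> 'o \<times> 'v \<Rightarrow> 'o \<times> 'v) \<Rightarrow> 'a \<Rightarrow> 'v \<Rightarrow> 'v" where
  "fibre_map G act g v = snd (act g (gsrc G g, v))"

locale groupoid_representation =
  groupoid G + continuous_hilbert_family "mtop (Obj G)" E \<Gamma>
  for G :: "('o, 'a) groupoid_data" and E :: "'o \<Rightarrow> 'v hilbert" and \<Gamma> :: "('o \<Rightarrow> 'v) set" +
  fixes act :: "'a \<Rightarrow> 'o \<times> 'v \<Rightarrow> 'o \<times> 'v"
  assumes act_continuous:
      "continuous_map
         (subtopology (prod_topology (mtop (Arr G)) (total_topology (mtop (Obj G)) E \<Gamma>))
            {(g, e). gsrc G g = fst e})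
         (total_topology (mtop (Obj G)) E \<Gamma>) (\<lambda>(g, e). act g e)"
    and act_proj: "\<lbrakk>g \<in> arrows G; v \<in> carrier (E (gsrc G g))\<rbrakk>
        \<Longrightarrow> fst (act g (gsrc G g, v)) = gtgt G g"
    and act_unit: "\<lbrakk>x \<in> objects G; v \<in> carrier (E x)\<rbrakk> \<Longrightarrow> act (gunit G x) (x, v) = (x, v)"
    and act_comp: "\<lbrakk>(h, g) \<in> composable G; v \<in> carrier (E (gsrc G g))\<rbrakk>
        \<Longrightarrow> act h (act g (gsrc G g, v)) = act (gcomp G h g) (gsrc G g, v)"
    and act_linear: "g \<in> arrows G \<Longrightarrow> linear_iso (E (gsrc G g)) (E (gtgt G g)) (fibre_map G act g)"

locale unitary_representation = groupoid_representation +
  assumes act_unitary: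
    "g \<in> arrows G \<Longrightarrow> unitary_map (E (gsrc G g)) (E (gtgt G g)) (fibre_map G act g)"

locale faithful_representation = groupoid_representation +
  assumes act_faithful: "\<lbrakk>x \<in> objects G; g \<in> hom_arrows G x x; h \<in> hom_arrows G x x;
      \<And>v. v \<in> carrier (E x) \<Longrightarrow> act g (x, v) = act h (x, v)\<rbrakk> \<Longrightarrow> g = h"

end

theory Submission
  imports Defs
begin

text \<open>
  Let \<open>c\<close> be a cutoff function: continuous on the objects, not identically zero on any orbit, and such
  that every object has a neighbourhood \<open>V\<close> for which the arrows \<open>g\<close> into \<open>V\<close> with \<open>c (s g) \<noteq> 0\<close> lie in a
  compact set. Put \<open>E x = \<ell>\<^sup>2(F x)\<close>, where \<open>F x\<close> is the set of arrows \<open>g\<close> into \<open>x\<close> with \<open>c (s g) \<noteq> 0\<close>; it is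
  finite because target fibres are discrete. A section is continuous if, viewed as a function on the
  arrows that is \<open>0\<close> outside of the sets \<open>F x\<close>, it is continuous; thus the dimension may drop where \<open>c\<close>
  vanishes. Left translation maps \<open>F (s g)\<close> bijectively to \<open>F (t g)\<close>, so it acts unitarily, and
  faithfully since every \<open>F x\<close> is nonempty and isotropy groups act freely on it. All continuity
  statements reduce to the continuity of finite sums over the fibres of the etale map \<open>t\<close>.
  Only the weight \<open>a = c \<circ> s\<close> on arrows is needed.
\<close>

section \<open>Etale maps\<close>

lemma continuous_map_locallyI:
  assumes "\<And>x. x \<in> topspace X \<Longrightarrow> \<exists>U. openin X U \<and> x \<in> U \<and> continuous_map (subtopology X U) Y f"
  shows "continuous_map X Y f"
  unfolding continuous_map_eq_topcontinuous_at topcontinuous_at_def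
proof (intro ballI conjI allI impI)
  show "f \<in> topspace X \<rightarrow> topspace Y"
    using assms by (fastforce simp: continuous_map_def Pi_iff)
next
  fix x V assume x: "x \<in> topspace X" and V: "openin Y V \<and> f x \<in> V"
  obtain U where U: "openin X U" "x \<in> U" "continuous_map (subtopology X U) Y f"
    using assms[OF x] by blast
  have "openin (subtopology X U) {y \<in> topspace (subtopology X U). f y \<in> V}"
    using U(3) V openin_continuous_map_preimage by blast
  then have "openin X {y \<in> topspace (subtopology X U). f y \<in> V}"
    using U(1) openin_trans_full by blast
  then show "\<exists>U. openin X U \<and> x \<in> U \<and> (\<forall>y\<in>U. f y \<in> V)"
    using U x V by (intro exI[of _ "{y \<in> topspace (subtopology X U). f y \<in> V}"]) auto
qed auto

lemma continuous_map_euclidean_dist: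
  fixes f :: "'a \<Rightarrow> 'b::metric_space"
  shows "continuous_map X euclidean f \<longleftrightarrow>
    (\<forall>x\<in>topspace X. \<forall>\<epsilon>>0. \<exists>U. openin X U \<and> x \<in> U \<and> (\<forall>y\<in>U. dist (f y) (f x) < \<epsilon>))"
proof
  assume L: "continuous_map X euclidean f"
  show "\<forall>x\<in>topspace X. \<forall>\<epsilon>>0. \<exists>U. openin X U \<and> x \<in> U \<and> (\<forall>y\<in>U. dist (f y) (f x) < \<epsilon>)"
  proof (intro ballI allI impI)
    fix x and \<epsilon> :: real assume x: "x \<in> topspace X" "\<epsilon> > 0"
    have "openin X {y \<in> topspace X. f y \<in> ball (f x) \<epsilon>}"
      using L by (rule openin_continuous_map_preimage) simp
    then show "\<exists>U. openin X U \<and> x \<in> U \<and> (\<forall>y\<in>U. dist (f y) (f x) < \<epsilon>)"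
      using x by (intro exI[of _ "{y \<in> topspace X. f y \<in> ball (f x) \<epsilon>}"]) (auto simp: dist_commute)
  qed
next
  assume R: "\<forall>x\<in>topspace X. \<forall>\<epsilon>>0. \<exists>U. openin X U \<and> x \<in> U \<and> (\<forall>y\<in>U. dist (f y) (f x) < \<epsilon>)"
  show "continuous_map X euclidean f"
    unfolding continuous_map_eq_topcontinuous_at topcontinuous_at_def
  proof (intro ballI conjI allI impI)
    fix x V assume x: "x \<in> topspace X" and V: "openin euclidean V \<and> f x \<in> V"
    then obtain \<epsilon> where "\<epsilon> > 0" "\<And>z. dist z (f x) < \<epsilon> \<Longrightarrow> z \<in> V"
      by (auto simp: open_dist)
    then show "\<exists>U. openin X U \<and> x \<in> U \<and> (\<forall>y\<in>U. f y \<in> V)"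
      using R x by meson
  qed auto
qed

text \<open>Charts transport local compactness from open subsets of the model space to chart
  domains; these are open, so neighbourhoods found inside them are neighbourhoods in the whole
  space.\<close>

lemma locally_compact_smooth_manifold:
  assumes "smooth_manifold M"
  shows "locally_compact_space (mtop M)"
  unfolding locally_compact_space_def
proof
  fix x assume "x \<in> topspace (mtop M)"
  then obtain U \<phi> where U: "(U, \<phi>) \<in> matlas M" "x \<in> U"
    using assms unfolding smooth_manifold_def by blast
  then have c: "openin (mtop M) U" "openin (Euclidean_space (mdim M)) (\<phi> ` U)"
    "homeomorphic_map (subtopology (mtop M) U) (subtopology (Euclidean_space (mdim M)) (\<phi> ` U)) \<phi>"
    using assms unfolding smooth_manifold_def is_chart_def by blast+
  have "locally_compact_space (subtopology (Euclidean_space (mdim M)) (\<phi> ` U))"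
    by (intro locally_compact_space_open_subset c locally_compact_Euclidean_space
        disjI1 Hausdorff_Euclidean_space)
  then have "locally_compact_space (subtopology (mtop M) U)"
    using c(3) homeomorphic_locally_compact_space homeomorphic_map_imp_homeomorphic_space by blast
  moreover have "x \<in> topspace (subtopology (mtop M) U)"
    using U(2) c(1) openin_subset by fastforce
  ultimately obtain V K where "openin (subtopology (mtop M) U) V" "compactin (subtopology (mtop M) U) K"
    "x \<in> V" "V \<subseteq> K"
    unfolding locally_compact_space_def by blast
  then show "\<exists>V K. openin (mtop M) V \<and> compactin (mtop M) K \<and> x \<in> V \<and> V \<subseteq> K"
    using c(1) openin_trans_full compactin_subtopology by metis
qed

text \<open>Only the topological content of a local diffeomorphism is kept: on a small open set it
  has an open image and the continuous inverse \<open>\<kappa>\<close>.\<close>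

lemma local_diffeomorphism_local_section:
  assumes "local_diffeomorphism M N f" "p \<in> topspace (mtop M)"
  obtains U \<kappa> where "openin (mtop M) U" "p \<in> U" "openin (mtop N) (f ` U)"
    "continuous_map (subtopology (mtop N) (f ` U)) (mtop M) \<kappa>" "\<And>q. q \<in> U \<Longrightarrow> \<kappa> (f q) = q"
proof -
  obtain U where U: "openin (mtop M) U" "p \<in> U" "openin (mtop N) (f ` U)"
    "diffeomorphism (open_submanifold M U) (open_submanifold N (f ` U)) f"
    using assms unfolding local_diffeomorphism_def by blast
  have eq: "topspace (mtop (open_submanifold M U)) = U"
    using U(1) openin_subset by (fastforce simp: open_submanifold_def)
  have "continuous_map (subtopology (mtop N) (f ` U)) (subtopology (mtop M) U) (inv_into U f)"
    and "inj_on f U"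
    using U(4) eq unfolding diffeomorphism_def smooth_map_def bij_betw_def
    by (auto simp: open_submanifold_def)
  then show thesis
    using that[OF U(1-3), of "inv_into U f"] continuous_map_into_fulltopology inv_into_f_f by metis
qed

text \<open>Each local smooth extension is continuous, and continuity is a local property. This
  serves for the multiplication, whose smoothness is stated on the set of composable pairs.\<close>

lemma smooth_map_on_imp_continuous_map:
  assumes f: "smooth_map_on M S N f" and S: "S \<subseteq> topspace (mtop M)"
  shows "continuous_map (subtopology (mtop M) S) (mtop N) f"
proof (rule continuous_map_locallyI)
  fix p assume "p \<in> topspace (subtopology (mtop M) S)"
  then have "p \<in> S" by simp
  then obtain W F where W: "openin (mtop M) W" "p \<in> W" "smooth_map (open_submanifold M W) N F"
    "\<forall>x\<in>S \<inter> W. F x = f x"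
    using f unfolding smooth_map_on_def by blast
  have "continuous_map (subtopology (mtop M) W) (mtop N) F"
    using W(3) by (simp add: smooth_map_def open_submanifold_def)
  then have "continuous_map (subtopology (subtopology (mtop M) W) S) (mtop N) F"
    by (rule continuous_map_from_subtopology)
  then have "continuous_map (subtopology (subtopology (mtop M) W) S) (mtop N) f"
    by (rule continuous_map_eq) (use W(4) in auto)
  then have "continuous_map (subtopology (subtopology (mtop M) S) (S \<inter> W)) (mtop N) f"
    by (simp add: subtopology_subtopology Int_commute)
  then show "\<exists>U. openin (subtopology (mtop M) S) U \<and> p \<in> U
      \<and> continuous_map (subtopology (subtopology (mtop M) S) U) (mtop N) f"
    using W(1,2) \<open>p \<in> S\<close> by (intro exI[of _ "S \<inter> W"]) (auto simp: openin_subtopology_Int2)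
qed

text \<open>The equation \<open>\<kappa> (t q) = q\<close> makes \<open>t\<close> injective on
  \<open>U\<close>, so that \<open>t\<close> restricts to a homeomorphism of \<open>U\<close> onto
  an open set, with inverse \<open>\<kappa>\<close>.\<close>

locale etale_map =
  fixes X :: "'x topology" and B :: "'b topology" and t :: "'x \<Rightarrow> 'b"
  assumes Hausdorff_total: "Hausdorff_space X"
    and Hausdorff_base: "Hausdorff_space B"
    and continuous_proj: "continuous_map X B t"
    and local_section: "p \<in> topspace X \<Longrightarrow> \<exists>U \<kappa>. openin X U \<and> p \<in> U \<and> openin B (t ` U) \<and>
          continuous_map (subtopology B (t ` U)) X \<kappa> \<and> (\<forall>q\<in>U. \<kappa> (t q) = q)"
begin

text \<open>The fibre is closed in \<open>C\<close>, hence compact, and it is discrete because each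
  sheet \<open>U p\<close> contains only one of its points.\<close>

lemma finite_fibre_compactin:
  assumes C: "compactin X C" and x: "x \<in> topspace B"
  shows "finite {p \<in> C. t p = x}"
proof -
  define D where "D = {p \<in> C. t p = x}"
  have sub: "C \<subseteq> topspace X"
    using C compactin_subset_topspace by blast
  have "closedin X {p \<in> topspace X. t p \<in> {x}}"
    using x by (intro closedin_continuous_map_preimage[OF continuous_proj])
      (simp add: Hausdorff_base closedin_Hausdorff_singleton)
  moreover have "D = {p \<in> topspace X. t p \<in> {x}} \<inter> C"
    using sub by (auto simp: D_def)
  ultimately have "compactin X D"
    using closed_Int_compactin C by metis
  obtain U where U: "\<And>p. p \<in> topspace X \<Longrightarrow> openin X (U p) \<and> p \<in> U p \<and> inj_on t (U p)"
    using local_section inj_on_inverseI by metis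
  have D: "D \<subseteq> topspace X"
    using sub by (auto simp: D_def)
  have "\<exists>\<F>. finite \<F> \<and> \<F> \<subseteq> U ` D \<and> D \<subseteq> \<Union>\<F>"
  proof (rule compactinD[OF \<open>compactin X D\<close>])
    show "openin X V" if "V \<in> U ` D" for V using U D that by blast
    show "D \<subseteq> \<Union>(U ` D)" using U D by blast
  qed
  then obtain F where F: "finite F" "F \<subseteq> D" "D \<subseteq> \<Union>(U ` F)"
    by (metis finite_subset_image)
  have "D \<subseteq> F"
  proof
    fix q assume "q \<in> D"
    then obtain p where "p \<in> F" "q \<in> U p" using F(3) by blast
    then have "q = p"
      using U[of p] F(2) D \<open>q \<in> D\<close> unfolding D_def inj_on_def by blast
    then show "q \<in> F" using \<open>p \<in> F\<close> by simp
  qed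
  then show ?thesis
    using F(1) finite_subset D_def by blast
qed

text \<open>The points of \<open>C\<close> over \<open>W\<close> lie on finitely many disjoint
  sheets, one through each point of \<open>C\<close> over \<open>x\<close>. The sheets may leave
  \<open>C\<close>, so only containment is claimed. Disjointness is a Hausdorff argument; covering
  holds because images of compact sets are closed.\<close>

lemma compactin_local_sections:
  assumes C: "compactin X C" and x: "x \<in> topspace B"
  obtains W \<kappa> where "openin B W" "x \<in> W"
    "\<And>p. \<lbrakk>p \<in> C; t p = x\<rbrakk> \<Longrightarrow> continuous_map (subtopology B W) X (\<kappa> p)"
    "\<And>p y. \<lbrakk>p \<in> C; t p = x; y \<in> W\<rbrakk> \<Longrightarrow> t (\<kappa> p y) = y"
    "\<And>y. y \<in> W \<Longrightarrow> inj_on (\<lambda>p. \<kappa> p y) {p \<in> C. t p = x}"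
    "\<And>q. \<lbrakk>q \<in> C; t q \<in> W\<rbrakk> \<Longrightarrow> \<exists>p. p \<in> C \<and> t p = x \<and> q = \<kappa> p (t q)"
proof -
  define D where "D = {p \<in> C. t p = x}"
  have finD: "finite D"
    using finite_fibre_compactin[OF assms] by (simp add: D_def)
  have sub: "C \<subseteq> topspace X"
    using C compactin_subset_topspace by blast
  then have D: "D \<subseteq> topspace X"
    by (auto simp: D_def)
  obtain U \<kappa> where U: "\<And>p. p \<in> topspace X \<Longrightarrow> openin X (U p) \<and> p \<in> U p \<and> openin B (t ` U p) \<and>
      continuous_map (subtopology B (t ` U p)) X (\<kappa> p) \<and> (\<forall>q\<in>U p. \<kappa> p (t q) = q)"
    using local_section by metis
  \<comment> \<open>The factor \<open>topspace B\<close> keeps this a subset of the base when no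
    point of \<open>C\<close> lies over \<open>x\<close>.\<close>
  define W0 where "W0 = topspace B \<inter> (\<Inter>p\<in>D. t ` U p)"
  have W0: "openin B W0"
    unfolding W0_def using finD U D
    by (subst Int_commute, intro openin_INT) auto
  have xW0: "x \<in> W0"
    using x U D by (force simp: W0_def D_def)
  have cont: "continuous_map (subtopology B W0) X (\<kappa> p)" if "p \<in> D" for p
    using U[of p] D that continuous_map_from_subtopology_mono[of B "t ` U p" X "\<kappa> p" W0]
    by (auto simp: W0_def)
  have tk: "t (\<kappa> p y) = y" if "p \<in> D" "y \<in> W0" for p y
    using U[of p] D that by (force simp: W0_def)
  have kx: "\<kappa> p x = p" if "p \<in> D" for p
    using U[of p] D that by (force simp: D_def)
  \<comment> \<open>Distinct sections take distinct values \<open>p\<close> and \<open>p'\<close> at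
    \<open>x\<close>, and the set where they differ is open because \<open>X\<close> is
    Hausdorff.\<close>
  define K where "K p p' = {y \<in> topspace (subtopology B W0). \<kappa> p y \<noteq> \<kappa> p' y}" for p p'
  have K: "openin B (K p p')" if "p \<in> D" "p' \<in> D" for p p'
  proof -
    have "closedin (subtopology B W0) {y \<in> topspace (subtopology B W0). \<kappa> p y = \<kappa> p' y}"
      using closedin_continuous_maps_eq[OF Hausdorff_total] cont that by blast
    then have "openin (subtopology B W0) (topspace (subtopology B W0) -
        {y \<in> topspace (subtopology B W0). \<kappa> p y = \<kappa> p' y})"
      by blast
    moreover have "\<dots> = K p p'" by (auto simp: K_def)
    ultimately show ?thesis using W0 openin_trans_full by metis
  qed
  define W1 where "W1 = W0 \<inter> (\<Inter>(p,p')\<in>{(p,p') \<in> D \<times> D. p \<noteq> p'}. K p p')"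
  have W1: "openin B W1"
  proof (cases "{(p,p') \<in> D \<times> D. p \<noteq> p'} = {}")
    case True
    then show ?thesis using W0 unfolding W1_def by (simp only: True) simp
  next
    case False
    have "finite {(p,p') \<in> D \<times> D. p \<noteq> p'}"
      using finD by (auto intro: finite_subset[of _ "D \<times> D"])
    then show ?thesis
      unfolding W1_def using W0 K False by (intro openin_Int openin_INT2) auto
  qed
  have xW1: "x \<in> W1"
    using xW0 kx x by (auto simp: W1_def K_def)
  \<comment> \<open>\<open>R\<close> is the part of \<open>C\<close> that the sheets miss. Its image
    is closed and does not contain \<open>x\<close>; once it is removed from the base, all points of
    \<open>C\<close> above the rest lie on sheets.\<close>
  define R where "R = C - (\<Union>p\<in>D. U p)"
  have "closedin X (topspace X - (\<Union>p\<in>D. U p))"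
    using U D by (intro closedin_diff closedin_topspace openin_Union) auto
  moreover have "R = (topspace X - (\<Union>p\<in>D. U p)) \<inter> C"
    using sub by (auto simp: R_def)
  ultimately have "compactin X R"
    using closed_Int_compactin C by metis
  then have "closedin B (t ` R)"
    using continuous_proj image_compactin Hausdorff_base compactin_imp_closedin by metis
  moreover have "x \<notin> t ` R"
    using U D by (force simp: R_def D_def)
  ultimately have W: "openin B (W1 - t ` R)" "x \<in> W1 - t ` R"
    using W1 xW1 by (auto intro: openin_diff)
  show thesis
  proof (rule that[of "W1 - t ` R" \<kappa>])
    show "continuous_map (subtopology B (W1 - t ` R)) X (\<kappa> p)" if "p \<in> C" "t p = x" for p
      using cont[of p] that continuous_map_from_subtopology_mono[of B W0 X "\<kappa> p" "W1 - t ` R"]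
      by (auto simp: D_def W1_def)
    show "t (\<kappa> p y) = y" if "p \<in> C" "t p = x" "y \<in> W1 - t ` R" for p y
      using tk[of p y] that by (auto simp: D_def W1_def)
    show "inj_on (\<lambda>p. \<kappa> p y) {p \<in> C. t p = x}" if "y \<in> W1 - t ` R" for y
      using that by (auto simp: inj_on_def W1_def K_def D_def)
    show "\<exists>p. p \<in> C \<and> t p = x \<and> q = \<kappa> p (t q)" if "q \<in> C" "t q \<in> W1 - t ` R" for q
    proof -
      have "q \<in> C" "q \<notin> R" using that by blast+
      then obtain p where "p \<in> D" "q \<in> U p" by (auto simp: R_def)
      then have "\<kappa> p (t q) = q" using U[of p] D by blast
      then show ?thesis using \<open>p \<in> D\<close> unfolding D_def by (metis (mono_tags, lifting) mem_Collect_eq)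
    qed
  qed (use W in auto)
qed

text \<open>
  The pullback of \<open>t\<close> along \<open>u\<close> is again etale; near a point the sum runs over finitely many local
  sections.
\<close>

lemma continuous_map_fibre_sum:
  fixes \<psi> :: "'z \<Rightarrow> 'x \<Rightarrow> 'c::real_normed_vector"
  assumes u: "continuous_map Z B u"
    and \<psi>: "continuous_map (subtopology (prod_topology Z X) {(z, k). u z = t k}) euclidean (\<lambda>(z, k). \<psi> z k)"
    and S: "\<And>x. S x \<subseteq> {k \<in> topspace X. t k = x}"
    and zero: "\<And>z k. \<lbrakk>z \<in> topspace Z; k \<in> topspace X; u z = t k; k \<notin> S (t k)\<rbrakk> \<Longrightarrow> \<psi> z k = 0"
    and compact: "\<And>x. x \<in> topspace B \<Longrightarrow>
        \<exists>V C. openin B V \<and> x \<in> V \<and> compactin X C \<and> (\<forall>y\<in>V. S y \<subseteq> C)"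
  shows "continuous_map Z euclidean (\<lambda>z. \<Sum>k\<in>S (u z). \<psi> z k)"
proof (rule continuous_map_locallyI)
  fix z0 assume z0: "z0 \<in> topspace Z"
  then have x: "u z0 \<in> topspace B"
    using u continuous_map_image_subset_topspace by blast
  obtain V C where V: "openin B V" "u z0 \<in> V" "compactin X C" "\<And>y. y \<in> V \<Longrightarrow> S y \<subseteq> C"
    using compact[OF x] by metis
  define D where "D = {p \<in> C. t p = u z0}"
  have finD: "finite D"
    using finite_fibre_compactin[OF V(3) x] by (simp add: D_def)
  obtain W \<kappa> where W: "openin B W" "u z0 \<in> W"
    "\<And>p. p \<in> D \<Longrightarrow> continuous_map (subtopology B W) X (\<kappa> p)"
    "\<And>p y. \<lbrakk>p \<in> D; y \<in> W\<rbrakk> \<Longrightarrow> t (\<kappa> p y) = y"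
    "\<And>y. y \<in> W \<Longrightarrow> inj_on (\<lambda>p. \<kappa> p y) D"
    "\<And>q. \<lbrakk>q \<in> C; t q \<in> W\<rbrakk> \<Longrightarrow> \<exists>p\<in>D. q = \<kappa> p (t q)"
    using compactin_local_sections[OF V(3) x] unfolding D_def by (smt (verit) mem_Collect_eq)
  define O' where "O' = {z \<in> topspace Z. u z \<in> V \<inter> W}"
  have O': "openin Z O'" "z0 \<in> O'"
    using openin_continuous_map_preimage[OF u, of "V \<inter> W"] V W z0 by (auto simp: O'_def)
  have topO: "topspace (subtopology Z O') = O'"
    by (auto simp: O'_def)
  have uW: "continuous_map (subtopology Z O') (subtopology B W) u"
    using u by (auto simp: continuous_map_in_subtopology O'_def continuous_map_from_subtopology)
  have summand: "continuous_map (subtopology Z O') euclidean (\<lambda>z. \<psi> z (\<kappa> p (u z)))" if p: "p \<in> D" for p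
  proof -
    have "continuous_map (subtopology Z O') X (\<lambda>z. \<kappa> p (u z))"
      using continuous_map_compose[OF uW W(3)[OF p]] by (simp add: o_def)
    then have "continuous_map (subtopology Z O') (subtopology (prod_topology Z X) {(z, k). u z = t k})
        (\<lambda>z. (z, \<kappa> p (u z)))"
      using W(4)[OF p] by (auto simp: continuous_map_in_subtopology continuous_map_pairedI
          continuous_map_from_subtopology topO O'_def)
    from continuous_map_compose[OF this \<psi>] show ?thesis by (simp add: o_def)
  qed
  have eq: "(\<Sum>p\<in>D. \<psi> z (\<kappa> p (u z))) = (\<Sum>k\<in>S (u z). \<psi> z k)" if z: "z \<in> O'" for z
  proof -
    have uz: "u z \<in> V" "u z \<in> W" "z \<in> topspace Z" using z by (auto simp: O'_def)
    have im: "(\<lambda>p. \<kappa> p (u z)) ` D \<subseteq> {k \<in> topspace X. t k = u z}"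
      using W(3,4) uz openin_subset[OF W(1)] by (fastforce simp: continuous_map_def Pi_iff)
    have sub: "S (u z) \<subseteq> (\<lambda>p. \<kappa> p (u z)) ` D"
    proof
      fix k assume k: "k \<in> S (u z)"
      then have "t k = u z" "k \<in> C" using S V(4) uz by auto
      then show "k \<in> (\<lambda>p. \<kappa> p (u z)) ` D" using W(6)[of k] uz by auto
    qed
    have "(\<Sum>p\<in>D. \<psi> z (\<kappa> p (u z))) = (\<Sum>k\<in>(\<lambda>p. \<kappa> p (u z)) ` D. \<psi> z k)"
      by (subst sum.reindex[OF W(5)[OF uz(2)]]) (simp add: o_def)
    \<comment> \<open>All of \<open>S (u z)\<close> lies in \<open>C\<close> and hence on the
      sheets. The sheets may contain further points, which contribute nothing by
      \<open>zero\<close>.\<close>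
    also have "\<dots> = (\<Sum>k\<in>S (u z). \<psi> z k)"
      by (rule sum.mono_neutral_right) (use finD sub im zero uz in auto)
    finally show ?thesis .
  qed
  have "continuous_map (subtopology Z O') euclidean (\<lambda>z. \<Sum>p\<in>D. \<psi> z (\<kappa> p (u z)))"
    using finD summand by (intro continuous_map_sum) auto
  then have "continuous_map (subtopology Z O') euclidean (\<lambda>z. \<Sum>k\<in>S (u z). \<psi> z k)"
    by (rule continuous_map_eq) (use eq topO in auto)
  then show "\<exists>U. openin Z U \<and> z0 \<in> U \<and>
      continuous_map (subtopology Z U) euclidean (\<lambda>z. \<Sum>k\<in>S (u z). \<psi> z k)"
    using O' by blast
qed

end


section \<open>Finite-dimensional Hilbert spaces\<close>

lemma complex_field_simps [simp]:
  "carrier complex_field = UNIV" "a \<otimes>\<^bsub>complex_field\<^esub> b = a * b" "\<one>\<^bsub>complex_field\<^esub> = 1"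
  "\<zero>\<^bsub>complex_field\<^esub> = 0" "a \<oplus>\<^bsub>complex_field\<^esub> b = a + b"
  by (simp_all add: complex_field_def)

lemma cring_complex_field: "cring complex_field"
proof (rule cringI)
  show "abelian_group complex_field"
    by (rule abelian_groupI) (auto intro: exI[of _ "- _"] simp: add.commute[of _ "- _"])
  show "Group.comm_monoid complex_field"
    by (rule comm_monoidI) auto
qed (auto simp: algebra_simps)

text \<open>
  Addition truncates to \<open>I\<close>, so that negation, a definite description, takes the expected value even
  outside of the carrier. Otherwise \<open>\<lambda>u v. hnorm H (u \<ominus> v)\<close> would not be symmetric there, as
  \<^locale>\<open>Metric_space\<close> demands.
\<close>

definition l2 :: "'i set \<Rightarrow> ('i \<Rightarrow> complex) hilbert" where
  "l2 I = \<lparr>carrier = {v. \<forall>i. i \<notin> I \<longrightarrow> v i = 0}, monoid.mult = (\<lambda>v w i. v i * w i), one = (\<lambda>i. 1),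
     ring.zero = (\<lambda>i. 0), add = (\<lambda>v w i. if i \<in> I then v i + w i else 0), smult = (\<lambda>c v i. c * v i),
     hinner = (\<lambda>v w. \<Sum>i\<in>I. v i * cnj (w i))\<rparr>"

lemma l2_simps [simp]:
  "v \<in> carrier (l2 I) \<longleftrightarrow> (\<forall>i. i \<notin> I \<longrightarrow> v i = 0)"
  "\<zero>\<^bsub>l2 I\<^esub> = (\<lambda>i. 0)"
  "v \<oplus>\<^bsub>l2 I\<^esub> w = (\<lambda>i. if i \<in> I then v i + w i else 0)"
  "c \<odot>\<^bsub>l2 I\<^esub> v = (\<lambda>i. c * v i)"
  "hinner (l2 I) v w = (\<Sum>i\<in>I. v i * cnj (w i))"
  by (simp_all add: l2_def)

lemma abelian_group_l2: "abelian_group (l2 I)"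
proof (rule abelian_groupI)
  fix v assume "v \<in> carrier (l2 I)"
  then show "\<exists>w\<in>carrier (l2 I). w \<oplus>\<^bsub>l2 I\<^esub> v = \<zero>\<^bsub>l2 I\<^esub>"
    by (intro bexI[of _ "\<lambda>i. - v i"]) auto
qed (auto simp: add.assoc add.commute fun_eq_iff)

lemma module_l2: "Module.module complex_field (l2 I)"
  by (rule moduleI) (auto simp: cring_complex_field abelian_group_l2 algebra_simps)

text \<open>Values outside of \<open>I\<close> never enter the equation that characterises the
  inverse, so the formula holds for arbitrary functions, and the norm lemmas below carry no
  membership conditions.\<close>

lemma l2_minus: "v \<ominus>\<^bsub>l2 I\<^esub> w = (\<lambda>i. if i \<in> I then v i - w i else 0)"
proof -
  have "\<ominus>\<^bsub>l2 I\<^esub> w = (\<lambda>i. if i \<in> I then - w i else 0)"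
    unfolding a_inv_def m_inv_def
    by (rule the_equality) (auto simp: fun_eq_iff add_eq_0_iff split: if_splits)
  then show ?thesis by (simp add: a_minus_def cong: if_cong)
qed

lemma hnorm_l2: "hnorm (l2 I) v = L2_set (\<lambda>i. cmod (v i)) I"
proof -
  have "Re (\<Sum>i\<in>I. v i * cnj (v i)) = (\<Sum>i\<in>I. (cmod (v i))\<^sup>2)"
    by (simp add: cmod_power2) (simp add: power2_eq_square)
  then show ?thesis by (simp add: hnorm_def L2_set_def)
qed

lemma hnorm_l2_minus: "hnorm (l2 I) (v \<ominus>\<^bsub>l2 I\<^esub> w) = L2_set (\<lambda>i. cmod (v i - w i)) I"
  by (simp add: l2_minus hnorm_l2 cong: L2_set_cong_simp)

lemma hnorm_l2_minus_triangle:
  "hnorm (l2 I) (u \<ominus>\<^bsub>l2 I\<^esub> w) \<le> hnorm (l2 I) (u \<ominus>\<^bsub>l2 I\<^esub> v) + hnorm (l2 I) (v \<ominus>\<^bsub>l2 I\<^esub> w)"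
  unfolding hnorm_l2_minus
proof (rule order_trans[OF L2_set_mono L2_set_triangle_ineq])
  show "cmod (u i - w i) \<le> cmod (u i - v i) + cmod (v i - w i)" for i
    using norm_triangle_ineq[of "u i - v i" "v i - w i"] by simp
qed simp

lemma hnorm_l2_minus_commute: "hnorm (l2 I) (v \<ominus>\<^bsub>l2 I\<^esub> w) = hnorm (l2 I) (w \<ominus>\<^bsub>l2 I\<^esub> v)"
  by (simp add: hnorm_l2_minus norm_minus_commute)

lemma cmod_diff_le_hnorm_l2:
  assumes "finite I" "i \<in> I"
  shows "cmod (v i - w i) \<le> hnorm (l2 I) (v \<ominus>\<^bsub>l2 I\<^esub> w)"
  unfolding hnorm_l2_minus using member_le_L2_set[OF assms, of "\<lambda>i. cmod (v i - w i)"] by simp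

text \<open>Expansion of the squared norm. Through it, invariance and continuity of inner products
  pass to norms of differences.\<close>

lemma hnorm_l2_minus_eq:
  "hnorm (l2 I) (v \<ominus>\<^bsub>l2 I\<^esub> w) =
     sqrt (Re (hinner (l2 I) v v) + Re (hinner (l2 I) w w) - 2 * Re (hinner (l2 I) v w))"
proof -
  have "(cmod (x - y))\<^sup>2 = Re (x * cnj x) + Re (y * cnj y) - 2 * Re (x * cnj y)" for x y
    by (simp only: cmod_power2) (simp add: power2_eq_square algebra_simps)
  then show ?thesis
    by (simp only: hnorm_l2_minus L2_set_def l2_simps Re_sum sum.distrib sum_subtractf sum_distrib_left)
qed

lemma Metric_space_l2:
  assumes "finite I"
  shows "Metric_space (carrier (l2 I)) (\<lambda>u v. hnorm (l2 I) (u \<ominus>\<^bsub>l2 I\<^esub> v))"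
proof
  show "hnorm (l2 I) (u \<ominus>\<^bsub>l2 I\<^esub> v) = 0 \<longleftrightarrow> u = v" if "u \<in> carrier (l2 I)" "v \<in> carrier (l2 I)" for u v
    using that assms by (fastforce simp: hnorm_l2_minus L2_set_eq_0_iff fun_eq_iff)
qed (rule hnorm_l2_minus_commute hnorm_l2_minus_triangle | simp add: hnorm_l2_minus L2_set_nonneg)+

text \<open>Coordinates are bounded by the norm, so a Cauchy sequence converges coordinatewise; as
  \<open>I\<close> is finite, it then converges in norm. The limit is set to \<open>0\<close>
  outside of \<open>I\<close> to stay in the carrier.\<close>

lemma mcomplete_l2:
  assumes I: "finite I"
  shows "Metric_space.mcomplete (carrier (l2 I)) (\<lambda>u v. hnorm (l2 I) (u \<ominus>\<^bsub>l2 I\<^esub> v))"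
proof -
  interpret Metric_space "carrier (l2 I)" "\<lambda>u v. hnorm (l2 I) (u \<ominus>\<^bsub>l2 I\<^esub> v)"
    using I by (rule Metric_space_l2)
  show ?thesis
    unfolding mcomplete_def
  proof (intro allI impI)
    fix \<sigma> assume \<sigma>: "MCauchy \<sigma>"
    have "\<exists>l. (\<lambda>n. \<sigma> n i) \<longlonglongrightarrow> l" if i: "i \<in> I" for i
    proof -
      have "Cauchy (\<lambda>n. \<sigma> n i)"
        unfolding Cauchy_def dist_norm
      proof (intro allI impI)
        fix e :: real assume "e > 0"
        then obtain N where "\<And>m n. N \<le> m \<Longrightarrow> N \<le> n \<Longrightarrow> hnorm (l2 I) (\<sigma> m \<ominus>\<^bsub>l2 I\<^esub> \<sigma> n) < e"
          using \<sigma> unfolding MCauchy_def by meson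
        then show "\<exists>N. \<forall>m\<ge>N. \<forall>n\<ge>N. cmod (\<sigma> m i - \<sigma> n i) < e"
          using cmod_diff_le_hnorm_l2[OF I i] by (meson le_less_trans)
      qed
      then show ?thesis using Cauchy_convergent convergent_def by blast
    qed
    then obtain l where l: "\<And>i. i \<in> I \<Longrightarrow> (\<lambda>n. \<sigma> n i) \<longlonglongrightarrow> l i"
      by metis
    define x where "x i = (if i \<in> I then l i else 0)" for i
    have "(\<lambda>n. hnorm (l2 I) (\<sigma> n \<ominus>\<^bsub>l2 I\<^esub> x)) \<longlonglongrightarrow> sqrt (\<Sum>i\<in>I. (cmod (x i - x i))\<^sup>2)"
      unfolding hnorm_l2_minus L2_set_def
      using l by (intro tendsto_intros) (simp add: x_def)
    then have "(\<lambda>n. hnorm (l2 I) (\<sigma> n \<ominus>\<^bsub>l2 I\<^esub> x)) \<longlonglongrightarrow> 0"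
      by simp
    then have "limitin mtopology \<sigma> x sequentially"
      using \<sigma> unfolding limit_metric_sequentially MCauchy_def
      by (auto simp: x_def lim_sequentially dist_real_def image_subset_iff hnorm_l2_minus L2_set_nonneg)
    then show "\<exists>x. limitin mtopology \<sigma> x sequentially" by blast
  qed
qed

lemma hilbert_space_l2:
  assumes "finite I"
  shows "hilbert_space (l2 I)"
proof (intro hilbert_space.intro module_l2 hilbert_space_axioms.intro mcomplete_l2 assms)
  fix v assume v: "v \<in> carrier (l2 I)" "v \<noteq> \<zero>\<^bsub>l2 I\<^esub>"
  then obtain j where j: "j \<in> I" "v j \<noteq> 0"
    by (auto simp: fun_eq_iff)
  have "0 < (\<Sum>i\<in>I. (cmod (v i))\<^sup>2)"
    using assms j by (intro sum_pos2[of I j]) auto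
  also have "\<dots> = Re (hinner (l2 I) v v)"
    by (simp add: cmod_power2) (simp add: power2_eq_square)
  finally show "0 < Re (hinner (l2 I) v v)" .
qed (simp_all add: sum.distrib sum_distrib_left algebra_simps)

lemma finite_dimensional_l2:
  fixes I :: "'i set"
  assumes I: "finite I"
  shows "finite_dimensional (l2 I)"
  unfolding finite_dimensional_def
proof (intro exI conjI ballI)
  define e :: "'i \<Rightarrow> 'i \<Rightarrow> complex" where "e i = (\<lambda>j. if j = i then 1 else 0)" for i
  interpret abelian_group "l2 I" by (rule abelian_group_l2)
  show "finite (e ` I)" using I by simp
  show "e ` I \<subseteq> carrier (l2 I)" by (auto simp: e_def)
  fix v assume v: "v \<in> carrier (l2 I)"
  have inj: "inj e" by (auto simp: inj_def e_def fun_eq_iff split: if_splits)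
  \<comment> \<open>Coefficients are functions of the basis vector and not of its index, hence
    \<open>inv_into UNIV e\<close>. Partial sums over \<open>J\<close> make the expansion accessible
    to induction.\<close>
  have "(\<Oplus>\<^bsub>l2 I\<^esub>b\<in>e ` J. v (inv_into UNIV e b) \<odot>\<^bsub>l2 I\<^esub> b) = (\<lambda>i. if i \<in> J then v i else 0)" if "J \<subseteq> I" for J
    using finite_subset[OF that I] that
  proof (induction J rule: finite_induct)
    case empty
    then show ?case by simp
  next
    case (insert j J)
    have IH: "(\<Oplus>\<^bsub>l2 I\<^esub>b\<in>e ` J. v (inv_into UNIV e b) \<odot>\<^bsub>l2 I\<^esub> b) = (\<lambda>i. if i \<in> J then v i else 0)"
      using insert by simp
    have "e j \<notin> e ` J" using insert(2) inj by (simp add: inj_image_mem_iff)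
    then have "(\<Oplus>\<^bsub>l2 I\<^esub>b\<in>insert (e j) (e ` J). v (inv_into UNIV e b) \<odot>\<^bsub>l2 I\<^esub> b) =
        (v (inv_into UNIV e (e j)) \<odot>\<^bsub>l2 I\<^esub> e j) \<oplus>\<^bsub>l2 I\<^esub> (\<Oplus>\<^bsub>l2 I\<^esub>b\<in>e ` J. v (inv_into UNIV e b) \<odot>\<^bsub>l2 I\<^esub> b)"
      using insert by (intro finsum_insert) (auto simp: e_def)
    also have "\<dots> = (\<lambda>i. if i \<in> insert j J then v i else 0)"
      unfolding IH inv_f_f[OF inj] using insert.hyps insert.prems by (auto simp: e_def fun_eq_iff)
    finally show ?case by simp
  qed
  from this[of I] show "v = (\<Oplus>\<^bsub>l2 I\<^esub>b\<in>e ` I. v (inv_into UNIV e b) \<odot>\<^bsub>l2 I\<^esub> b)"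
    using v by (auto simp: fun_eq_iff)
qed


section \<open>Invariant weights\<close>

text \<open>A locally compact Hausdorff space is completely regular, which gives a bump function at
  each point; second countability implies the Lindelof property, which selects countably many of
  them.\<close>

lemma countable_bump_cover:
  assumes X: "locally_compact_space X" "Hausdorff_space X" "second_countable X"
  obtains f :: "nat \<Rightarrow> 'a \<Rightarrow> real" and K
  where "\<And>n. continuous_map X euclideanreal (f n)" "\<And>n. compactin X (K n)"
    "\<And>n x. x \<in> topspace X \<Longrightarrow> 0 \<le> f n x" "\<And>n x. \<lbrakk>x \<in> topspace X; f n x \<noteq> 0\<rbrakk> \<Longrightarrow> x \<in> K n"
    "\<And>x. x \<in> topspace X \<Longrightarrow> \<exists>n. 0 < f n x"
proof -
  have cr: "completely_regular_space X"
    using X locally_compact_Hausdorff_imp_regular_space locally_compact_regular_imp_completely_regular_space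
    by blast
  define bump where "bump x f K \<longleftrightarrow> continuous_map X euclideanreal f \<and> compactin X K \<and>
      (\<forall>y\<in>topspace X. 0 \<le> f y \<and> (f y \<noteq> 0 \<longrightarrow> y \<in> K)) \<and> 0 < f x" for x :: 'a and f :: "'a \<Rightarrow> real" and K
  have "\<exists>f K. bump x f K" if x: "x \<in> topspace X" for x
  proof -
    obtain U K where U: "openin X U" "compactin X K" "x \<in> U" "U \<subseteq> K"
      using X(1) x unfolding locally_compact_space_def by blast
    obtain f :: "'a \<Rightarrow> real" where f: "continuous_map X (top_of_set {0..1}) f" "f x = 0"
      "f ` (topspace X - U) \<subseteq> {1}"
      using cr U x unfolding completely_regular_space_def
      by (metis DiffD2 Diff_iff closedin_diff closedin_topspace)
    have "continuous_map X euclideanreal f" and f01: "\<And>y. y \<in> topspace X \<Longrightarrow> f y \<in> {0..1}"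
      using f(1) by (auto simp: continuous_map_in_subtopology)
    \<comment> \<open>The separating function is \<open>0\<close> at \<open>x\<close> and
      \<open>1\<close> off \<open>U\<close>, so the bump is its complement, which vanishes outside
      of \<open>K\<close>.\<close>
    then have "continuous_map X euclideanreal (\<lambda>y. 1 - f y)"
      by (intro continuous_intros) auto
    moreover have "0 \<le> 1 - f y \<and> (1 - f y \<noteq> 0 \<longrightarrow> y \<in> K)" if "y \<in> topspace X" for y
      using f01[OF that] f(3) U(4) that by (auto simp: image_subset_iff)
    ultimately show ?thesis
      unfolding bump_def using U(2) f(2) by (intro exI[of _ "\<lambda>y. 1 - f y"] exI[of _ K]) auto
  qed
  then obtain f K where "\<And>x. x \<in> topspace X \<Longrightarrow> bump x (f x) (K x)"
    by metis
  note f = this[unfolded bump_def]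
  define P where "P x = {y \<in> topspace X. f x y \<in> {0<..}}" for x
  have op: "openin X (P x)" if "x \<in> topspace X" for x
    unfolding P_def using f[OF that] by (intro openin_continuous_map_preimage[of _ euclideanreal]) auto
  have un: "\<Union>(P ` topspace X) = topspace X"
    using f by (auto simp: P_def)
  have "\<exists>\<V>. countable \<V> \<and> \<V> \<subseteq> P ` topspace X \<and> \<Union>\<V> = topspace X"
    by (rule Lindelof_spaceD[OF second_countable_imp_Lindelof_space[OF X(3)]]) (use op un in auto)
  then obtain A where A: "countable A" "A \<subseteq> topspace X" "\<Union>(P ` A) = topspace X"
    by (metis countable_subset_image)
  show thesis
  \<comment> \<open>\<open>from_nat_into\<close> enumerates a nonempty countable set, possibly with
    repetitions; on an empty space zero functions do.\<close>
  proof (cases "A = {}")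
    case True
    then have "topspace X = {}" using A(3) by simp
    then show ?thesis by (intro that[of "\<lambda>_ _. 0" "\<lambda>_. {}"]) auto
  next
    case False
    define \<alpha> where "\<alpha> = from_nat_into A"
    have \<alpha>: "\<alpha> n \<in> topspace X" for n
      using from_nat_into[OF False] A(2) by (auto simp: \<alpha>_def)
    show ?thesis
    proof (rule that[of "\<lambda>n. f (\<alpha> n)" "\<lambda>n. K (\<alpha> n)"])
      fix x assume "x \<in> topspace X"
      then obtain y where "y \<in> A" "x \<in> P y" using A(3) by blast
      then show "\<exists>n. 0 < f (\<alpha> n) x"
        using from_nat_into_surj[OF A(1)] by (auto simp: P_def \<alpha>_def)
    qed (use f \<alpha> in blast)+
  qed
qed

section \<open>Cancellation laws in a groupoid\<close>

context groupoid
begin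

lemma comp_arrow:
  assumes "h \<in> arrows G" "g \<in> arrows G" "gsrc G h = gtgt G g"
  shows "gcomp G h g \<in> arrows G" "gsrc G (gcomp G h g) = gsrc G g" "gtgt G (gcomp G h g) = gtgt G h"
  using comp_closed[of h g] assms by (auto simp: composable_def hom_arrows_def)

lemma inv_arrow:
  assumes "g \<in> arrows G"
  shows "ginv G g \<in> arrows G" "gsrc G (ginv G g) = gtgt G g" "gtgt G (ginv G g) = gsrc G g"
  using inv_closed[OF assms] by (auto simp: hom_arrows_def)

lemma unit_arrow:
  assumes "x \<in> objects G"
  shows "gunit G x \<in> arrows G" "gsrc G (gunit G x) = x" "gtgt G (gunit G x) = x"
  using unit_closed[OF assms] by (auto simp: hom_arrows_def)

lemma inv_comp_cancel:
  assumes "g \<in> arrows G" "k \<in> arrows G" "gsrc G g = gtgt G k"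
  shows "gcomp G (ginv G g) (gcomp G g k) = k"
  using comp_assoc[of "ginv G g" g k] assms by (simp add: composable_def inv_arrow comp_inv_left comp_unit_left)

lemma comp_inv_cancel:
  assumes "g \<in> arrows G" "k \<in> arrows G" "gtgt G g = gtgt G k"
  shows "gcomp G g (gcomp G (ginv G g) k) = k"
  using comp_assoc[of g "ginv G g" k] assms by (simp add: composable_def inv_arrow comp_inv_right comp_unit_left)

lemma inv_unit: "x \<in> objects G \<Longrightarrow> ginv G (gunit G x) = gunit G x"
  by (metis comp_inv_right comp_unit_left inv_arrow(1,3) unit_arrow)

text \<open>Stated as applied to an arrow \<open>k\<close>, the form in which it meets composed
  translations. The product of \<open>h\<close>, \<open>g\<close> and the right-hand side is
  \<open>k\<close>; cancelling \<open>gcomp G h g\<close> gives the claim.\<close>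

lemma inv_comp:
  assumes "h \<in> arrows G" "g \<in> arrows G" "gsrc G h = gtgt G g" "k \<in> arrows G" "gtgt G k = gtgt G h"
  shows "gcomp G (ginv G (gcomp G h g)) k = gcomp G (ginv G g) (gcomp G (ginv G h) k)"
proof -
  let ?k = "gcomp G (ginv G g) (gcomp G (ginv G h) k)"
  have k: "?k \<in> arrows G" "gtgt G ?k = gsrc G g"
    using assms by (simp_all add: comp_arrow inv_arrow)
  have "gcomp G (gcomp G h g) ?k = gcomp G h (gcomp G g ?k)"
    using assms k by (intro comp_assoc) (simp_all add: composable_def comp_arrow)
  also have "\<dots> = k"
    using assms by (simp add: comp_inv_cancel comp_arrow inv_arrow)
  finally show ?thesis
    using inv_comp_cancel[of "gcomp G h g" ?k] assms k by (simp add: comp_arrow)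
qed

end

section \<open>Topology of an orbifold groupoid and construction of the weight\<close>

context orbifold_groupoid
begin

lemma continuous_src: "continuous_map (mtop (Arr G)) (mtop (Obj G)) (gsrc G)"
  using submersion_src by (simp add: submersion_def smooth_map_def)

lemma continuous_tgt: "continuous_map (mtop (Arr G)) (mtop (Obj G)) (gtgt G)"
  using submersion_tgt by (simp add: submersion_def smooth_map_def)

lemma continuous_inv: "continuous_map (mtop (Arr G)) (mtop (Arr G)) (ginv G)"
  using smooth_inv by (simp add: smooth_map_def)

lemma continuous_comp:
  "continuous_map (subtopology (prod_topology (mtop (Arr G)) (mtop (Arr G))) (composable G))
     (mtop (Arr G)) (\<lambda>(h, g). gcomp G h g)"
  using smooth_map_on_imp_continuous_map[OF smooth_comp]
  by (auto simp: prod_manifold_def composable_def arrows_def)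

lemma locally_compact_Obj: "locally_compact_space (mtop (Obj G))"
  using manifold_Obj by (rule locally_compact_smooth_manifold)

lemma etale_map_tgt: "etale_map (mtop (Arr G)) (mtop (Obj G)) (gtgt G)"
proof
  fix p assume "p \<in> topspace (mtop (Arr G))"
  then obtain U \<kappa> where "openin (mtop (Arr G)) U" "p \<in> U" "openin (mtop (Obj G)) (gtgt G ` U)"
    "continuous_map (subtopology (mtop (Obj G)) (gtgt G ` U)) (mtop (Arr G)) \<kappa>"
    "\<And>q. q \<in> U \<Longrightarrow> \<kappa> (gtgt G q) = q"
    using local_diffeomorphism_local_section[OF local_diffeo_tgt] by metis
  then show "\<exists>U \<kappa>. openin (mtop (Arr G)) U \<and> p \<in> U \<and> openin (mtop (Obj G)) (gtgt G ` U) \<and>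
      continuous_map (subtopology (mtop (Obj G)) (gtgt G ` U)) (mtop (Arr G)) \<kappa> \<and>
      (\<forall>q\<in>U. \<kappa> (gtgt G q) = q)"
    by blast
qed (rule Hausdorff_Arr Hausdorff_Obj continuous_tgt)+

lemma compactin_arrows_between:
  assumes "compactin (mtop (Obj G)) K" "compactin (mtop (Obj G)) L"
  shows "compactin (mtop (Arr G)) {g \<in> arrows G. gsrc G g \<in> K \<and> gtgt G g \<in> L}"
proof -
  have "compactin (prod_topology (mtop (Obj G)) (mtop (Obj G))) (K \<times> L)"
    using assms by (simp add: compactin_Times)
  from compactin_proper_map_preimage[OF proper_anchor this] show ?thesis
    by (simp add: arrows_def mem_Times_iff)
qed

text \<open>A compact neighbourhood \<open>L\<close> of \<open>x\<close> bounds the targets, so that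
  properness of the anchor map applies. This is the source of local finiteness for fibre sums along
  the target map.\<close>

lemma compactin_arrows_into:
  assumes K: "compactin (mtop (Obj G)) K" and x: "x \<in> objects G"
  obtains V C where "openin (mtop (Obj G)) V" "x \<in> V" "compactin (mtop (Arr G)) C"
    "\<And>g. \<lbrakk>g \<in> arrows G; gsrc G g \<in> K; gtgt G g \<in> V\<rbrakk> \<Longrightarrow> g \<in> C"
proof -
  obtain V L where "openin (mtop (Obj G)) V" "compactin (mtop (Obj G)) L" "x \<in> V" "V \<subseteq> L"
    using locally_compact_Obj x unfolding locally_compact_space_def objects_def by blast
  then show thesis
    using that[of V "{g \<in> arrows G. gsrc G g \<in> K \<and> gtgt G g \<in> L}"] compactin_arrows_between[OF K] by blast
qed

text \<open>
  With \<open>f n\<close> compactly supported bump functions whose positivity sets cover the objects and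
  \<open>F n x = (\<Sum>k \<in> t\<^sup>-\<^sup>1 x. f n (s k))\<close>, an invariant function, the weight is
  \<open>a g = (\<Sum>n. f n (s g) * max 0 (1 - n * (\<Sum>i<n. F i (t g))))\<close>. The second factor vanishes for large
  \<open>n\<close>, locally uniformly, and it is \<open>1\<close> for the first \<open>n\<close> with \<open>F n (t g) > 0\<close>.
\<close>

lemma exists_invariant_weight:
  obtains a :: "'a \<Rightarrow> real"
  where "continuous_map (mtop (Arr G)) euclideanreal a"
    "\<And>h g. (h, g) \<in> composable G \<Longrightarrow> a (gcomp G h g) = a g"
    "\<And>x. x \<in> objects G \<Longrightarrow> \<exists>g\<in>arrows G. gtgt G g = x \<and> a g \<noteq> 0"
    "\<And>x. x \<in> objects G \<Longrightarrow> \<exists>V C. openin (mtop (Obj G)) V \<and> x \<in> V \<and> compactin (mtop (Arr G)) C \<and>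
        {g \<in> arrows G. gtgt G g \<in> V \<and> a g \<noteq> 0} \<subseteq> C"
proof -
  interpret etale_map "mtop (Arr G)" "mtop (Obj G)" "gtgt G"
    by (rule etale_map_tgt)
  obtain f :: "nat \<Rightarrow> 'o \<Rightarrow> real" and K where
    f: "\<And>n. continuous_map (mtop (Obj G)) euclideanreal (f n)" "\<And>n. compactin (mtop (Obj G)) (K n)"
    "\<And>n x. x \<in> objects G \<Longrightarrow> 0 \<le> f n x" "\<And>n x. \<lbrakk>x \<in> objects G; f n x \<noteq> 0\<rbrakk> \<Longrightarrow> x \<in> K n"
    "\<And>x. x \<in> objects G \<Longrightarrow> \<exists>n. 0 < f n x"
    using countable_bump_cover[OF locally_compact_Obj Hausdorff_Obj second_countable_Obj]
    unfolding objects_def by metis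
  \<comment> \<open>A target fibre may be infinite, and \<open>sum\<close> over an infinite set is
    \<open>0\<close>; discarding the zero summands leaves a finite set.\<close>
  define S where "S n x = {k \<in> arrows G. gtgt G k = x \<and> f n (gsrc G k) \<noteq> 0}" for n x
  define F where "F n x = (\<Sum>k\<in>S n x. f n (gsrc G k))" for n x
  define h where "h n x = max 0 (1 - real n * (\<Sum>i<n. F i x))" for n x
  define a where "a g = (\<Sum>n. f n (gsrc G g) * h n (gtgt G g))" for g
  have S_local: "\<exists>V C. openin (mtop (Obj G)) V \<and> x \<in> V \<and> compactin (mtop (Arr G)) C \<and> (\<forall>y\<in>V. S n y \<subseteq> C)"
    if x: "x \<in> objects G" for n x
  proof -
    obtain V C where "openin (mtop (Obj G)) V" "x \<in> V" "compactin (mtop (Arr G)) C"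
      "\<And>g. \<lbrakk>g \<in> arrows G; gsrc G g \<in> K n; gtgt G g \<in> V\<rbrakk> \<Longrightarrow> g \<in> C"
      using compactin_arrows_into[OF f(2) x] by metis
    then show ?thesis
      using f(4) src_closed by (intro exI[of _ V] exI[of _ C]) (auto simp: S_def)
  qed
  have F_cont: "continuous_map (mtop (Obj G)) euclideanreal (F n)" for n
    unfolding F_def
  proof (rule continuous_map_fibre_sum[where u = "\<lambda>x. x"])
    have "continuous_map (subtopology (prod_topology (mtop (Obj G)) (mtop (Arr G))) A) euclideanreal
        (\<lambda>z. f n (gsrc G (snd z)))" for A
      using continuous_map_compose[OF continuous_map_compose[OF continuous_map_snd continuous_src] f(1)]
      by (intro continuous_map_from_subtopology) (simp add: o_def)
    then show "continuous_map (subtopology (prod_topology (mtop (Obj G)) (mtop (Arr G)))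
        {(x, k). x = gtgt G k}) euclideanreal (\<lambda>(x, k). f n (gsrc G k))"
      by (simp add: case_prod_unfold)
  qed (use S_local in \<open>auto simp: S_def arrows_def objects_def\<close>)
  have F_nonneg: "0 \<le> F n x" for n x
    unfolding F_def S_def using f(3) src_closed by (intro sum_nonneg) auto
  have F_inv: "F n (gtgt G g) = F n (gsrc G g)" if g: "g \<in> arrows G" for n g
  proof -
    \<comment> \<open>Left multiplication by \<open>g\<close> preserves sources, hence the summands
      of \<open>F\<close>, and multiplication by the inverse of \<open>g\<close> undoes it.\<close>
    have "bij_betw (gcomp G g) (S n (gsrc G g)) (S n (gtgt G g))"
      by (rule bij_betw_byWitness[where f' = "gcomp G (ginv G g)"])
        (use g in \<open>auto simp: S_def comp_arrow inv_arrow inv_comp_cancel comp_inv_cancel\<close>)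
    from sum.reindex_bij_betw[OF this, of "\<lambda>k. f n (gsrc G k)"] show ?thesis
      using g by (simp add: F_def S_def comp_arrow)
  qed
  have F_pos: "\<exists>n. 0 < F n x" if x: "x \<in> objects G" for x
  proof -
    obtain n where n: "0 < f n x" using f(5)[OF x] by blast
    obtain V C where "compactin (mtop (Arr G)) C" "S n x \<subseteq> C"
      using S_local[OF x, of n] by blast
    then have "finite (S n x)"
      using finite_fibre_compactin[of C x] x
      by (auto simp: objects_def S_def elim!: finite_subset[rotated])
    \<comment> \<open>The unit at \<open>x\<close> has source and target \<open>x\<close>, so it
      contributes the positive term \<open>f n x\<close> to a finite sum of nonnegative
      terms.\<close>
    then have "0 < F n x"
      unfolding F_def using n unit_arrow[OF x] f(3) src_closed
      by (intro sum_pos2[of _ "gunit G x"]) (auto simp: S_def)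
    then show ?thesis by blast
  qed
  have h_cont: "continuous_map (mtop (Obj G)) euclideanreal (h n)" for n
    unfolding h_def by (intro continuous_intros F_cont) auto
  have h_nonneg: "0 \<le> h n x" for n x
    by (simp add: h_def)
  have h_local: "\<exists>V N. openin (mtop (Obj G)) V \<and> x \<in> V \<and> (\<forall>y\<in>V. \<forall>n\<ge>N. h n y = 0)"
    if x: "x \<in> objects G" for x
  proof -
    obtain m where m: "0 < F m x" using F_pos[OF x] by blast
    \<comment> \<open>\<open>F m\<close> still exceeds half of its value at \<open>x\<close> on a
      neighbourhood. There, for \<open>n > m\<close>, the partial sum exceeds
      \<open>\<delta>\<close>, and \<open>n \<ge> 1 / \<delta>\<close> brings its multiple by
      \<open>n\<close> to at least \<open>1\<close>.\<close>
    define \<delta> where "\<delta> = F m x / 2"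
    have \<delta>: "0 < \<delta>" "\<delta> < F m x" using m by (auto simp: \<delta>_def)
    define V where "V = {y \<in> topspace (mtop (Obj G)). F m y \<in> {\<delta><..}}"
    obtain N where N: "1 / \<delta> \<le> real N" using real_arch_simple by blast
    have "h n y = 0" if "y \<in> V" "n \<ge> max (Suc m) N" for n y
    proof -
      have "1 \<le> real n * \<delta>"
        using N that(2) \<delta>(1) by (simp add: divide_le_eq) (meson le_trans mult_right_mono of_nat_mono order_less_imp_le order_trans)
      also have "\<dots> \<le> real n * (\<Sum>i<n. F i y)"
      proof (intro mult_left_mono)
        have "F m y \<le> (\<Sum>i<n. F i y)"
          using that(2) F_nonneg by (intro member_le_sum) auto
        then show "\<delta> \<le> (\<Sum>i<n. F i y)" using that(1) by (auto simp: V_def)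
      qed simp
      finally show ?thesis by (simp add: h_def)
    qed
    moreover have "openin (mtop (Obj G)) V"
      unfolding V_def using F_cont by (intro openin_continuous_map_preimage[of _ euclideanreal]) auto
    moreover have "x \<in> V" using x \<delta> by (auto simp: V_def objects_def)
    ultimately show ?thesis by blast
  qed
  \<comment> \<open>The series is finite wherever \<open>h\<close> vanishes from \<open>N\<close>
    on; by \<open>h_local\<close> one \<open>N\<close> serves all targets in a
    neighbourhood.\<close>
  have a_eq: "a g = (\<Sum>n<N. f n (gsrc G g) * h n (gtgt G g))" if "\<And>n. n \<ge> N \<Longrightarrow> h n (gtgt G g) = 0" for g N
    unfolding a_def using that by (intro suminf_finite) auto
  show thesis
  proof (rule that[of a])
    show "continuous_map (mtop (Arr G)) euclideanreal a"
    proof (rule continuous_map_locallyI)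
      fix g assume g: "g \<in> topspace (mtop (Arr G))"
      then obtain V N where V: "openin (mtop (Obj G)) V" "gtgt G g \<in> V" "\<And>y n. y \<in> V \<Longrightarrow> n \<ge> N \<Longrightarrow> h n y = 0"
        using h_local[OF tgt_closed] unfolding arrows_def by metis
      define U where "U = {g \<in> topspace (mtop (Arr G)). gtgt G g \<in> V}"
      have "continuous_map (mtop (Arr G)) euclideanreal (\<lambda>g. \<Sum>n<N. f n (gsrc G g) * h n (gtgt G g))"
        using continuous_map_compose[OF continuous_src f(1)] continuous_map_compose[OF continuous_tgt h_cont]
        by (intro continuous_intros) (auto simp: o_def)
      then have "continuous_map (subtopology (mtop (Arr G)) U) euclideanreal
          (\<lambda>g. \<Sum>n<N. f n (gsrc G g) * h n (gtgt G g))"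
        by (rule continuous_map_from_subtopology)
      then have "continuous_map (subtopology (mtop (Arr G)) U) euclideanreal a"
        by (rule continuous_map_eq) (rule a_eq[symmetric], auto intro: V(3) simp: U_def)
      moreover have "openin (mtop (Arr G)) U"
        unfolding U_def using openin_continuous_map_preimage[OF continuous_tgt V(1)] .
      ultimately show "\<exists>U. openin (mtop (Arr G)) U \<and> g \<in> U \<and>
          continuous_map (subtopology (mtop (Arr G)) U) euclideanreal a"
        using g V(2) by (intro exI[of _ U]) (auto simp: U_def)
    qed
  next
    fix k g assume "(k, g) \<in> composable G"
    \<comment> \<open>The sources agree, and \<open>h n\<close> depends on the target only through
      the functions \<open>F i\<close>, which agree at both ends of \<open>k\<close>.\<close>
    then show "a (gcomp G k g) = a g"
      using F_inv by (simp add: a_def h_def composable_def comp_arrow)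
  next
    fix x assume x: "x \<in> objects G"
    \<comment> \<open>For the least such \<open>n\<close> all \<open>F i x\<close> with
      \<open>i < n\<close> vanish, so the cutoff \<open>h n x\<close> is \<open>1\<close>, while
      \<open>F n x > 0\<close> provides an arrow into \<open>x\<close> with a nonzero
      summand.\<close>
    define n where "n = (LEAST n. 0 < F n x)"
    have n: "0 < F n x"
      unfolding n_def by (rule LeastI_ex) (rule F_pos[OF x])
    have "F i x = 0" if "i < n" for i
      using not_less_Least[OF that[unfolded n_def]] F_nonneg[of i x] by linarith
    then have hn: "h n x = 1" by (simp add: h_def)
    have "S n x \<noteq> {}" using n by (auto simp: F_def)
    then obtain k where k: "k \<in> S n x" "f n (gsrc G k) \<noteq> 0"
      by (auto simp: S_def)
    then have k': "k \<in> arrows G" "gtgt G k = x" "0 < f n (gsrc G k)"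
      using f(3)[OF src_closed] by (auto simp: S_def less_le)
    obtain N where N: "\<And>n. n \<ge> N \<Longrightarrow> h n x = 0"
      using h_local[OF x] by blast
    have "n < N" using N[of n] hn by (cases "n < N") simp_all
    then have "0 < (\<Sum>n<N. f n (gsrc G k) * h n (gtgt G k))"
      using k' hn h_nonneg f(3)[OF src_closed[OF k'(1)]] by (intro sum_pos2[of _ n]) auto
    then have "0 < a k" using a_eq[of N k] N k'(2) by metis
    then show "\<exists>g\<in>arrows G. gtgt G g = x \<and> a g \<noteq> 0" using k' by force
  next
    fix x assume x: "x \<in> objects G"
    obtain V N where V: "openin (mtop (Obj G)) V" "x \<in> V" "\<And>y n. y \<in> V \<Longrightarrow> n \<ge> N \<Longrightarrow> h n y = 0"
      using h_local[OF x] by metis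
    \<comment> \<open>Over \<open>V\<close> only indices below \<open>N\<close> contribute, so a
      nonzero weight puts the source into one of finitely many compact sets.\<close>
    have "compactin (mtop (Obj G)) (\<Union>(K ` {..<N}))"
      using f(2) by (intro compactin_Union) auto
    then obtain V' C where V': "openin (mtop (Obj G)) V'" "x \<in> V'" "compactin (mtop (Arr G)) C"
      "\<And>g. \<lbrakk>g \<in> arrows G; gsrc G g \<in> (\<Union>(K ` {..<N})); gtgt G g \<in> V'\<rbrakk> \<Longrightarrow> g \<in> C"
      using compactin_arrows_into[OF _ x] by metis
    have "g \<in> C" if g: "g \<in> arrows G" "gtgt G g \<in> V \<inter> V'" "a g \<noteq> 0" for g
    proof -
      obtain n where "n < N" "f n (gsrc G g) \<noteq> 0"
        using a_eq[of N g] g V(3) by (metis (no_types, lifting) IntD1 lessThan_iff mult_eq_0_iff sum.neutral)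
      then show ?thesis using V'(4)[of g] g f(4)[OF src_closed] by blast
    qed
    then show "\<exists>V C. openin (mtop (Obj G)) V \<and> x \<in> V \<and> compactin (mtop (Arr G)) C \<and>
        {g \<in> arrows G. gtgt G g \<in> V \<and> a g \<noteq> 0} \<subseteq> C"
      using V V' by (intro exI[of _ "V \<inter> V'"] exI[of _ C]) auto
  qed
qed

end


section \<open>The weighted left regular representation\<close>

lemma continuous_map_mult:
  fixes f g :: "'a \<Rightarrow> 'b::real_normed_algebra"
  shows "\<lbrakk>continuous_map X euclidean f; continuous_map X euclidean g\<rbrakk>
    \<Longrightarrow> continuous_map X euclidean (\<lambda>x. f x * g x)"
  by (simp add: continuous_map_atin tendsto_mult)

lemma continuous_map_cnj:
  "continuous_map X euclidean f \<Longrightarrow> continuous_map X euclidean (\<lambda>x. cnj (f x))"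
  by (simp add: continuous_map_atin tendsto_cnj)

lemma continuous_map_Re:
  "continuous_map X euclidean f \<Longrightarrow> continuous_map X euclidean (\<lambda>x. Re (f x))"
  by (simp add: continuous_map_atin tendsto_Re)

lemma continuous_map_of_real:
  "continuous_map X euclideanreal f \<Longrightarrow>
    continuous_map X euclidean (\<lambda>x. of_real (f x) :: 'b::real_normed_algebra_1)"
  by (simp add: continuous_map_atin tendsto_of_real)

text \<open>Complete regularity separates each point of \<open>F\<close> from the others. On
  \<open>F\<close> the functions \<open>1 - f p\<close> are then Kronecker deltas, as in Lagrange
  interpolation.\<close>

lemma finite_interpolation:
  fixes c :: "'a \<Rightarrow> 'b::real_normed_algebra_1"
  assumes X: "completely_regular_space X" "Hausdorff_space X" and F: "finite F" "F \<subseteq> topspace X"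
  obtains \<phi> where "continuous_map X euclidean \<phi>" "\<And>p. p \<in> F \<Longrightarrow> \<phi> p = c p"
proof -
  have "\<exists>f :: 'a \<Rightarrow> real. continuous_map X euclideanreal f \<and> f p = 0 \<and> (\<forall>q\<in>F - {p}. f q = 1)"
    if p: "p \<in> F" for p
  proof -
    have "closedin X (F - {p}) \<and> p \<in> topspace X - (F - {p})"
      using X(2) F p by (auto intro!: closedin_Hausdorff_finite)
    then obtain f :: "'a \<Rightarrow> real" where "continuous_map X (top_of_set {0..1}) f" "f p = 0" "f ` (F - {p}) \<subseteq> {1}"
      using X(1)[unfolded completely_regular_space_def, rule_format, of "F - {p}" p] by blast
    then show ?thesis
      by (intro exI[of _ f]) (auto simp: continuous_map_in_subtopology)
  qed
  then obtain f :: "'a \<Rightarrow> 'a \<Rightarrow> real" where f: "\<And>p. p \<in> F \<Longrightarrow> continuous_map X euclideanreal (f p)"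
    "\<And>p. p \<in> F \<Longrightarrow> f p p = 0" "\<And>p q. \<lbrakk>p \<in> F; q \<in> F - {p}\<rbrakk> \<Longrightarrow> f p q = 1"
    by metis
  show thesis
  proof (rule that)
    show "continuous_map X euclidean (\<lambda>q. \<Sum>p\<in>F. c p * of_real (1 - f p q))"
      using F f(1)
      by (intro continuous_map_sum continuous_map_mult continuous_map_of_real continuous_map_diff) auto
    fix q assume q: "q \<in> F"
    have "(\<Sum>p\<in>F. c p * of_real (1 - f p q)) = (\<Sum>p\<in>F. if p = q then c p else 0)"
      using f q by (intro sum.cong) auto
    then show "(\<Sum>p\<in>F. c p * of_real (1 - f p q)) = c q"
      using q F(1) by simp
  qed
qed

text \<open>Taking the inverse of \<open>g\<close> for \<open>h\<close> in
  \<open>weight_comp\<close> shows that \<open>a g\<close> equals the weight of the unit at the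
  source of \<open>g\<close>. The weight is thus a function of the source, and left multiplication
  preserves its support.\<close>

locale weighted_orbifold_groupoid = orbifold_groupoid G
  for G :: "('o, 'a) groupoid_data" +
  fixes a :: "'a \<Rightarrow> real"
  assumes continuous_weight: "continuous_map (mtop (Arr G)) euclideanreal a"
    and weight_comp: "(h, g) \<in> composable G \<Longrightarrow> a (gcomp G h g) = a g"
    and weight_nonzero: "x \<in> objects G \<Longrightarrow> \<exists>g\<in>arrows G. gtgt G g = x \<and> a g \<noteq> 0"
    and weight_support: "x \<in> objects G \<Longrightarrow>
      \<exists>V C. openin (mtop (Obj G)) V \<and> x \<in> V \<and> compactin (mtop (Arr G)) C \<and>
        {g \<in> arrows G. gtgt G g \<in> V \<and> a g \<noteq> 0} \<subseteq> C"
begin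

sublocale tgt: etale_map "mtop (Arr G)" "mtop (Obj G)" "gtgt G"
  by (rule etale_map_tgt)

definition fib :: "'o \<Rightarrow> 'a set" where
  "fib x = {g \<in> arrows G. gtgt G g = x \<and> a g \<noteq> 0}"

text \<open>Numbers the finite set \<open>fib x\<close>, so that functions on it can live in
  \<open>nat \<Rightarrow> complex\<close>. The numbering need not vary continuously with
  \<open>x\<close>; continuity of sections is read off through \<open>coef\<close>.\<close>

definition idx :: "'a \<Rightarrow> nat" where
  "idx g = to_nat_on (fib (gtgt G g)) g"

definition E :: "'o \<Rightarrow> (nat \<Rightarrow> complex) hilbert" where
  "E x = l2 (idx ` fib x)"

definition enc :: "'o \<Rightarrow> ('a \<Rightarrow> complex) \<Rightarrow> nat \<Rightarrow> complex" where
  "enc x \<phi> i = (if i \<in> idx ` fib x then \<phi> (inv_into (fib x) idx i) else 0)"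

definition coef :: "('o \<Rightarrow> nat \<Rightarrow> complex) \<Rightarrow> 'a \<Rightarrow> complex" where
  "coef w g = (if a g \<noteq> 0 then w (gtgt G g) (idx g) else 0)"

definition sections :: "('o \<Rightarrow> nat \<Rightarrow> complex) set" where
  "sections = {w \<in> (\<Pi>\<^sub>E x\<in>objects G. carrier (E x)). continuous_map (mtop (Arr G)) euclidean (coef w)}"

text \<open>The left regular representation, sending \<open>v\<close> to the function
  \<open>k \<mapsto> v(g^-1 k)\<close>, in numbered coordinates.\<close>

definition translate :: "'a \<Rightarrow> (nat \<Rightarrow> complex) \<Rightarrow> nat \<Rightarrow> complex" where
  "translate g v = enc (gtgt G g) (\<lambda>k. v (idx (gcomp G (ginv G g) k)))"

definition act :: "'a \<Rightarrow> 'o \<times> (nat \<Rightarrow> complex) \<Rightarrow> 'o \<times> (nat \<Rightarrow> complex)" where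
  "act g e = (gtgt G g, translate g (snd e))"

section \<open>Fibres as finite-dimensional Hilbert spaces\<close>

lemma fib_local:
  assumes "x \<in> objects G"
  shows "\<exists>V C. openin (mtop (Obj G)) V \<and> x \<in> V \<and> compactin (mtop (Arr G)) C \<and> (\<forall>y\<in>V. fib y \<subseteq> C)"
proof -
  obtain V C where "openin (mtop (Obj G)) V" "x \<in> V" "compactin (mtop (Arr G)) C"
    "{g \<in> arrows G. gtgt G g \<in> V \<and> a g \<noteq> 0} \<subseteq> C"
    using weight_support[OF assms] by blast
  then show ?thesis
    by (intro exI[of _ V] exI[of _ C]) (auto simp: fib_def)
qed

lemma finite_fib: "finite (fib x)"
proof (cases "x \<in> objects G")
  case True
  then obtain C where "compactin (mtop (Arr G)) C" "fib x \<subseteq> C"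
    using fib_local by blast
  then show ?thesis
    using tgt.finite_fibre_compactin[of C x] True
    by (auto simp: objects_def fib_def elim!: finite_subset[rotated])
next
  case False
  then have "fib x = {}" using tgt_closed by (auto simp: fib_def)
  then show ?thesis by simp
qed

lemma inj_on_idx: "inj_on idx (fib x)"
proof -
  have "inj_on (to_nat_on (fib x)) (fib x)"
    using finite_fib by (intro inj_on_to_nat_on countable_finite)
  then show ?thesis
    by (rule inj_on_cong[THEN iffD1, rotated]) (auto simp: idx_def fib_def)
qed

lemma carrier_E: "v \<in> carrier (E x) \<longleftrightarrow> (\<forall>i. i \<notin> idx ` fib x \<longrightarrow> v i = 0)"
  by (simp add: E_def)

lemma enc_idx: "k \<in> fib x \<Longrightarrow> enc x \<phi> (idx k) = \<phi> k"
  by (simp add: enc_def inj_on_idx)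

lemma enc_carrier: "enc x \<phi> \<in> carrier (E x)"
  by (simp add: carrier_E enc_def)

lemma carrier_E_eqI:
  assumes "v \<in> carrier (E x)" "w \<in> carrier (E x)" "\<And>k. k \<in> fib x \<Longrightarrow> v (idx k) = w (idx k)"
  shows "v = w"
  using assms unfolding carrier_E by (metis (no_types, opaque_lifting) ext imageE)

lemma hinner_E: "hinner (E x) v w = (\<Sum>k\<in>fib x. v (idx k) * cnj (w (idx k)))"
  by (simp add: E_def sum.reindex[OF inj_on_idx])

lemma hilbert_space_E: "hilbert_space (E x)"
  unfolding E_def by (intro hilbert_space_l2 finite_imageI finite_fib)

lemma coef_fib: "k \<in> fib x \<Longrightarrow> coef w k = w x (idx k)"
  by (simp add: coef_def fib_def)

section \<open>Continuous sections and the axioms of a continuous family\<close>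

lemma section_enc:
  assumes "continuous_map (mtop (Arr G)) euclidean \<phi>" "\<And>g. \<lbrakk>g \<in> arrows G; a g = 0\<rbrakk> \<Longrightarrow> \<phi> g = 0"
  shows "(\<lambda>x\<in>objects G. enc x \<phi>) \<in> sections"
proof -
  have "continuous_map (mtop (Arr G)) euclidean (coef (\<lambda>x\<in>objects G. enc x \<phi>))"
    by (rule continuous_map_eq[OF assms(1)])
      (use assms(2) tgt_closed in \<open>auto simp: coef_def enc_idx fib_def arrows_def\<close>)
  then show ?thesis
    by (simp add: sections_def enc_carrier)
qed

lemma sections_carrier: "\<lbrakk>w \<in> sections; x \<in> objects G\<rbrakk> \<Longrightarrow> w x \<in> carrier (E x)"
  by (auto simp: sections_def)

lemma continuous_coef: "w \<in> sections \<Longrightarrow> continuous_map (mtop (Arr G)) euclidean (coef w)"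
  by (simp add: sections_def)

lemma completely_regular_Arr: "completely_regular_space (mtop (Arr G))"
  using locally_compact_smooth_manifold[OF manifold_Arr] Hausdorff_Arr
    locally_compact_Hausdorff_imp_regular_space locally_compact_regular_imp_completely_regular_space
  by blast

text \<open>An interpolating function need not vanish where \<open>a\<close> does. Multiplying it by
  \<open>a\<close> enforces this, and dividing the prescribed values by \<open>a k\<close>, which is
  nonzero on \<open>fib x\<close>, compensates.\<close>

lemma section_through:
  assumes x: "x \<in> objects G" and v: "v \<in> carrier (E x)"
  shows "\<exists>w\<in>sections. w x = v"
proof -
  have sub: "fib x \<subseteq> topspace (mtop (Arr G))"
    by (auto simp: fib_def arrows_def)
  obtain \<phi> where \<phi>: "continuous_map (mtop (Arr G)) euclidean \<phi>"
    "\<And>k. k \<in> fib x \<Longrightarrow> \<phi> k = v (idx k) / of_real (a k)"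
    using finite_interpolation[OF completely_regular_Arr Hausdorff_Arr finite_fib sub,
        where c = "\<lambda>k. v (idx k) / of_real (a k)"] by blast
  let ?w = "\<lambda>x\<in>objects G. enc x (\<lambda>g. \<phi> g * of_real (a g))"
  have "?w \<in> sections"
    by (intro section_enc continuous_map_mult continuous_map_of_real \<phi>(1) continuous_weight) simp
  moreover have "?w x = v"
    by (rule carrier_E_eqI[of _ x]) (use x v \<phi>(2) in \<open>auto simp: enc_carrier enc_idx fib_def\<close>)
  ultimately show ?thesis by blast
qed

text \<open>The inner product is a fibre sum of a continuous function on arrows that vanishes
  outside of the sets \<open>fib x\<close>.\<close>

lemma continuous_hinner_sections:
  assumes "s \<in> sections" "s' \<in> sections"
  shows "continuous_map (mtop (Obj G)) euclidean (\<lambda>x. hinner (E x) (s x) (s' x))"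
proof -
  let ?P = "prod_topology (mtop (Obj G)) (mtop (Arr G))"
  have coef_snd: "continuous_map (subtopology ?P A) euclidean (\<lambda>z. coef w (snd z))"
    if "w \<in> sections" for w A
    using continuous_map_compose[OF continuous_map_snd continuous_coef[OF that]]
    by (intro continuous_map_from_subtopology) (simp add: o_def)
  have "continuous_map (mtop (Obj G)) euclidean (\<lambda>x. \<Sum>k\<in>fib x. coef s k * cnj (coef s' k))"
  proof (rule tgt.continuous_map_fibre_sum[where u = "\<lambda>x. x"])
    show "continuous_map (subtopology ?P {(x, k). x = gtgt G k}) euclidean
        (\<lambda>(x, k). coef s k * cnj (coef s' k))"
      unfolding case_prod_unfold using assms by (intro continuous_map_mult continuous_map_cnj coef_snd)
  qed (use fib_local in \<open>auto simp: fib_def coef_def arrows_def objects_def\<close>)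
  then show ?thesis
    by (rule continuous_map_eq) (simp add: hinner_E coef_fib)
qed

text \<open>Turns approximation in the norms of the fibres into uniform approximation of the
  functions \<open>coef\<close>.\<close>

lemma coef_diff_le_hnorm:
  assumes "g \<in> arrows G"
  shows "cmod (coef s g - coef w g) \<le> hnorm (E (gtgt G g)) (s (gtgt G g) \<ominus>\<^bsub>E (gtgt G g)\<^esub> w (gtgt G g))"
proof (cases "a g = 0")
  case True
  then show ?thesis by (simp add: coef_def E_def hnorm_l2 L2_set_nonneg)
next
  case False
  then have g: "g \<in> fib (gtgt G g)" using assms by (simp add: fib_def)
  show ?thesis
    unfolding E_def coef_fib[OF g] by (intro cmod_diff_le_hnorm_l2 finite_imageI finite_fib imageI g)
qed

text \<open>Locally uniform limits of continuous functions are continuous: the functions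
  \<open>coef s\<close> approximate \<open>coef w\<close> on the arrows with target in
  \<open>U\<close>, and the error is split into three parts.\<close>

lemma section_of_local_approximation:
  assumes w: "w \<in> (\<Pi>\<^sub>E x\<in>objects G. carrier (E x))"
    and approx: "\<And>x \<epsilon>. \<lbrakk>x \<in> objects G; \<epsilon> > 0\<rbrakk> \<Longrightarrow>
      \<exists>U s. openin (mtop (Obj G)) U \<and> x \<in> U \<and> s \<in> sections \<and>
        (\<forall>y\<in>U. hnorm (E y) (s y \<ominus>\<^bsub>E y\<^esub> w y) < \<epsilon>)"
  shows "w \<in> sections"
proof -
  have "continuous_map (mtop (Arr G)) euclidean (coef w)"
    unfolding continuous_map_euclidean_dist
  proof (intro ballI allI impI)
    fix g and \<epsilon> :: real assume g: "g \<in> topspace (mtop (Arr G))" and \<epsilon>: "\<epsilon> > 0"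
    have x: "gtgt G g \<in> objects G" using g tgt_closed by (simp add: arrows_def)
    obtain U s where U: "openin (mtop (Obj G)) U" "gtgt G g \<in> U" "s \<in> sections"
      "\<And>y. y \<in> U \<Longrightarrow> hnorm (E y) (s y \<ominus>\<^bsub>E y\<^esub> w y) < \<epsilon> / 3"
      using approx[OF x, of "\<epsilon> / 3"] \<epsilon> by auto
    have "\<epsilon> / 3 > 0" using \<epsilon> by simp
    then obtain W where W: "openin (mtop (Arr G)) W" "g \<in> W" "\<And>h. h \<in> W \<Longrightarrow> dist (coef s h) (coef s g) < \<epsilon> / 3"
      using continuous_coef[OF U(3)] g unfolding continuous_map_euclidean_dist by meson
    define W' where "W' = W \<inter> {h \<in> topspace (mtop (Arr G)). gtgt G h \<in> U}"
    have close: "dist (coef s h) (coef w h) < \<epsilon> / 3" if "h \<in> W'" for h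
      using coef_diff_le_hnorm[of h s w] U(4)[of "gtgt G h"] that by (auto simp: W'_def arrows_def dist_norm)
    have gW: "g \<in> W'" using W g U by (simp add: W'_def)
    have "dist (coef w h) (coef w g) < \<epsilon>" if h: "h \<in> W'" for h
    proof -
      have "dist (coef s h) (coef s g) < \<epsilon> / 3" using W(3) h by (simp add: W'_def)
      then show ?thesis
        using close[OF h] close[OF gW] dist_triangle[of "coef w h" "coef w g" "coef s h"]
          dist_triangle[of "coef s h" "coef w g" "coef s g"]
        by (simp add: dist_commute)
    qed
    moreover have "openin (mtop (Arr G)) W'"
      unfolding W'_def using openin_continuous_map_preimage[OF continuous_tgt U(1)] W(1) by blast
    ultimately show "\<exists>U. openin (mtop (Arr G)) U \<and> g \<in> U \<and> (\<forall>h\<in>U. dist (coef w h) (coef w g) < \<epsilon>)"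
      using gW by blast
  qed
  then show ?thesis using w by (simp add: sections_def)
qed

lemma continuous_fd_hilbert_family: "continuous_fd_hilbert_family (mtop (Obj G)) E sections"
proof (intro continuous_fd_hilbert_family.intro continuous_hilbert_family.intro
    continuous_fd_hilbert_family_axioms.intro; (fold objects_def)?)
  show "locally_compact_space (mtop (Obj G))" "Hausdorff_space (mtop (Obj G))"
    by (rule locally_compact_Obj Hausdorff_Obj)+
  show "hilbert_space (E x)" for x by (rule hilbert_space_E)
  show "sections \<subseteq> (\<Pi>\<^sub>E x\<in>objects G. carrier (E x))"
    by (auto simp: sections_def)
  show "finite_dimensional (E x)" for x
    unfolding E_def by (intro finite_dimensional_l2 finite_imageI finite_fib)
  show "(\<lambda>x\<in>objects G. \<zero>\<^bsub>E x\<^esub>) \<in> sections"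
  proof -
    have "continuous_map (mtop (Arr G)) euclidean (\<lambda>_. 0 :: complex)"
      by simp
    then have "continuous_map (mtop (Arr G)) euclidean (coef (\<lambda>x\<in>objects G. \<zero>\<^bsub>E x\<^esub>))"
      by (rule continuous_map_eq) (auto simp: coef_def E_def tgt_closed arrows_def[symmetric])
    then show ?thesis by (simp add: sections_def E_def)
  qed
  show "(\<lambda>x\<in>objects G. s x \<oplus>\<^bsub>E x\<^esub> s' x) \<in> sections" if s: "s \<in> sections" "s' \<in> sections" for s s'
  proof -
    have "continuous_map (mtop (Arr G)) euclidean (\<lambda>g. coef s g + coef s' g)"
      using s by (intro continuous_map_add continuous_coef)
    then have "continuous_map (mtop (Arr G)) euclidean (coef (\<lambda>x\<in>objects G. s x \<oplus>\<^bsub>E x\<^esub> s' x))"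
      by (rule continuous_map_eq) (auto simp: coef_def E_def fib_def tgt_closed arrows_def[symmetric])
    then show ?thesis by (simp add: sections_def E_def)
  qed
  show "(\<lambda>x\<in>objects G. c \<odot>\<^bsub>E x\<^esub> s x) \<in> sections" if s: "s \<in> sections" for s c
  proof -
    have "continuous_map (mtop (Arr G)) euclidean (\<lambda>g. c * coef s g)"
      using s by (intro continuous_map_mult continuous_coef) auto
    then have "continuous_map (mtop (Arr G)) euclidean (coef (\<lambda>x\<in>objects G. c \<odot>\<^bsub>E x\<^esub> s x))"
      by (rule continuous_map_eq) (auto simp: coef_def E_def tgt_closed arrows_def[symmetric])
    moreover have "(\<lambda>i. c * s x i) \<in> carrier (E x)" if "x \<in> objects G" for x
      using sections_carrier[OF s that] by (simp add: carrier_E)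
    ultimately show ?thesis
      by (simp add: sections_def E_def)
  qed
qed (use section_through continuous_hinner_sections section_of_local_approximation in \<open>auto simp: objects_def\<close>)

section \<open>Left translation as a unitary and faithful action\<close>

lemma inv_comp_fib:
  assumes "g \<in> arrows G" "k \<in> fib (gtgt G g)"
  shows "gcomp G (ginv G g) k \<in> fib (gsrc G g)"
  using assms weight_comp[of "ginv G g" k] by (simp add: fib_def comp_arrow inv_arrow composable_def)

lemma comp_fib:
  assumes "g \<in> arrows G" "k \<in> fib (gsrc G g)"
  shows "gcomp G g k \<in> fib (gtgt G g)"
  using assms weight_comp[of g k] by (simp add: fib_def comp_arrow composable_def)

lemma bij_betw_inv_comp_fib:
  assumes "g \<in> arrows G"
  shows "bij_betw (gcomp G (ginv G g)) (fib (gtgt G g)) (fib (gsrc G g))"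
proof (rule bij_betw_byWitness[where f' = "gcomp G g"])
  show "\<forall>k\<in>fib (gtgt G g). gcomp G g (gcomp G (ginv G g) k) = k"
    using assms by (simp add: fib_def comp_inv_cancel)
  show "\<forall>k\<in>fib (gsrc G g). gcomp G (ginv G g) (gcomp G g k) = k"
    using assms by (simp add: fib_def inv_comp_cancel)
qed (use assms inv_comp_fib comp_fib in auto)

lemma translate_idx:
  "k \<in> fib (gtgt G g) \<Longrightarrow> translate g v (idx k) = v (idx (gcomp G (ginv G g) k))"
  by (simp add: translate_def enc_idx)

lemma translate_carrier: "translate g v \<in> carrier (E (gtgt G g))"
  by (simp add: translate_def enc_carrier)

lemma translate_comp:
  assumes "h \<in> arrows G" "g \<in> arrows G" "gsrc G h = gtgt G g"
  shows "translate h (translate g v) = translate (gcomp G h g) v"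
proof (rule carrier_E_eqI)
  show "translate h (translate g v) \<in> carrier (E (gtgt G h))"
    by (rule translate_carrier)
  show "translate (gcomp G h g) v \<in> carrier (E (gtgt G h))"
    using translate_carrier[of "gcomp G h g" v] assms by (simp add: comp_arrow)
  fix k assume k: "k \<in> fib (gtgt G h)"
  then have "gcomp G (ginv G h) k \<in> fib (gtgt G g)"
    using inv_comp_fib[OF assms(1)] assms(3) by simp
  then show "translate h (translate g v) (idx k) = translate (gcomp G h g) v (idx k)"
    using assms k by (simp add: translate_idx comp_arrow inv_comp fib_def)
qed

lemma translate_unit:
  assumes x: "x \<in> objects G" and v: "v \<in> carrier (E x)"
  shows "translate (gunit G x) v = v"
proof (rule carrier_E_eqI)
  show "translate (gunit G x) v \<in> carrier (E x)"
    using translate_carrier[of "gunit G x" v] x by (simp add: unit_arrow)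
  fix k assume k: "k \<in> fib x"
  then show "translate (gunit G x) v (idx k) = v (idx k)"
    using translate_idx[of k "gunit G x" v] comp_unit_left[of k] x
    by (auto simp: unit_arrow inv_unit fib_def)
qed (rule v)

text \<open>Left multiplication is a bijection between the two fibres and only reindexes the
  sum.\<close>

lemma hinner_translate:
  assumes "g \<in> arrows G"
  shows "hinner (E (gtgt G g)) (translate g u) (translate g v) = hinner (E (gsrc G g)) u v"
proof -
  have "hinner (E (gtgt G g)) (translate g u) (translate g v) =
      (\<Sum>k\<in>fib (gtgt G g). u (idx (gcomp G (ginv G g) k)) * cnj (v (idx (gcomp G (ginv G g) k))))"
    by (simp add: hinner_E translate_idx)
  also have "\<dots> = (\<Sum>k\<in>fib (gsrc G g). u (idx k) * cnj (v (idx k)))"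
    by (rule sum.reindex_bij_betw[OF bij_betw_inv_comp_fib[OF assms]])
  finally show ?thesis by (simp add: hinner_E)
qed

lemma hnorm_translate_minus:
  assumes "g \<in> arrows G"
  shows "hnorm (E (gtgt G g)) (translate g u \<ominus>\<^bsub>E (gtgt G g)\<^esub> translate g v) =
    hnorm (E (gsrc G g)) (u \<ominus>\<^bsub>E (gsrc G g)\<^esub> v)"
  unfolding E_def hnorm_l2_minus_eq by (simp only: hinner_translate[OF assms, unfolded E_def])

lemma fibre_map_act: "fibre_map G act g = translate g"
  by (simp add: fibre_map_def act_def fun_eq_iff)

lemma unitary_map_translate:
  assumes g: "g \<in> arrows G"
  shows "unitary_map (E (gsrc G g)) (E (gtgt G g)) (translate g)"
  unfolding unitary_map_def linear_iso_def
proof (intro conjI ballI allI)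
  have inv: "ginv G g \<in> arrows G" "gsrc G (ginv G g) = gtgt G g" "gtgt G (ginv G g) = gsrc G g"
    by (rule inv_arrow[OF g])+
  show "bij_betw (translate g) (carrier (E (gsrc G g))) (carrier (E (gtgt G g)))"
  proof (rule bij_betw_byWitness[where f' = "translate (ginv G g)"])
    show "\<forall>v\<in>carrier (E (gsrc G g)). translate (ginv G g) (translate g v) = v"
      using g inv by (simp add: translate_comp comp_inv_left translate_unit src_closed)
    show "\<forall>v\<in>carrier (E (gtgt G g)). translate g (translate (ginv G g) v) = v"
      using g inv by (simp add: translate_comp comp_inv_right translate_unit tgt_closed)
    show "translate g ` carrier (E (gsrc G g)) \<subseteq> carrier (E (gtgt G g))"
      using translate_carrier by blast
    show "translate (ginv G g) ` carrier (E (gtgt G g)) \<subseteq> carrier (E (gsrc G g))"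
      using translate_carrier[of "ginv G g"] inv by auto
  qed
  show "translate g (u \<oplus>\<^bsub>E (gsrc G g)\<^esub> v) = translate g u \<oplus>\<^bsub>E (gtgt G g)\<^esub> translate g v" for u v
    by (rule carrier_E_eqI[OF translate_carrier])
      (use inv_comp_fib[OF g] in \<open>auto simp: E_def translate_idx\<close>)
  show "translate g (c \<odot>\<^bsub>E (gsrc G g)\<^esub> v) = c \<odot>\<^bsub>E (gtgt G g)\<^esub> translate g v" for c v
    using translate_carrier[of g v]
    by (intro carrier_E_eqI[OF translate_carrier]) (auto simp: carrier_E, auto simp: E_def translate_idx)
  show "hinner (E (gtgt G g)) (translate g u) (translate g v) = hinner (E (gsrc G g)) u v" for u v
    by (rule hinner_translate[OF g])
qed

text \<open>Translation by \<open>g\<close> carries the unit vector at \<open>k\<close> to the one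
  at \<open>g k\<close>. Equal translations therefore force \<open>g k = h k\<close>, and
  \<open>k\<close> cancels; such a \<open>k\<close> exists because the weight is not zero on all
  arrows into \<open>x\<close>.\<close>

lemma translate_faithful:
  assumes g: "g \<in> hom_arrows G x x" and h: "h \<in> hom_arrows G x x"
    and eq: "\<And>v. v \<in> carrier (E x) \<Longrightarrow> translate g v = translate h v"
  shows "g = h"
proof -
  have g': "g \<in> arrows G" "gsrc G g = x" "gtgt G g = x" and h': "h \<in> arrows G" "gsrc G h = x" "gtgt G h = x"
    using g h by (auto simp: hom_arrows_def)
  have "x \<in> objects G" using g' src_closed by blast
  then obtain k where k: "k \<in> fib x"
    using weight_nonzero by (auto simp: fib_def)
  define \<delta> where "\<delta> = enc x (\<lambda>l. if l = k then 1 else 0)"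
  have gk: "gcomp G g k \<in> fib x" using comp_fib[of g k] g' k by simp
  have k': "k \<in> arrows G" "gtgt G k = x" using k by (auto simp: fib_def)
  have "translate g \<delta> (idx (gcomp G g k)) = 1"
    using g' gk k k' by (simp add: translate_idx inv_comp_cancel \<delta>_def enc_idx)
  then have "translate h \<delta> (idx (gcomp G g k)) = 1"
    using eq[of \<delta>] by (simp add: \<delta>_def enc_carrier)
  moreover have "gcomp G (ginv G h) (gcomp G g k) \<in> fib x"
    using inv_comp_fib[of h "gcomp G g k"] h' gk by simp
  ultimately have "gcomp G (ginv G h) (gcomp G g k) = k"
    using h' gk by (simp add: translate_idx \<delta>_def enc_idx split: if_splits)
  then have eq': "gcomp G g k = gcomp G h k"
    using comp_inv_cancel[of h "gcomp G g k"] g' h' k' by (simp add: comp_arrow)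
  have "gcomp G (gcomp G l k) (ginv G k) = l" if "l \<in> arrows G" "gsrc G l = x" for l
    using comp_assoc[of l k "ginv G k"] that k' comp_unit_right[of l]
    by (simp add: composable_def inv_arrow comp_inv_right)
  then show ?thesis using eq' g' h' by metis
qed

text \<open>Expanding the squared norm leaves the norms of two sections, the translated one being
  measured at the source by unitarity, and a mixed inner product. The latter is a fibre sum over
  pairs of arrows with equal target; its summands are continuous because
  \<open>(g, k) \<mapsto> g^-1 k\<close> is.\<close>

lemma continuous_hnorm_translate_sections:
  assumes s: "s \<in> sections" and \<sigma>: "\<sigma> \<in> sections"
  shows "continuous_map (mtop (Arr G)) euclideanreal
    (\<lambda>g. hnorm (E (gtgt G g)) (s (gtgt G g) \<ominus>\<^bsub>E (gtgt G g)\<^esub> translate g (\<sigma> (gsrc G g))))"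
proof -
  let ?P = "subtopology (prod_topology (mtop (Arr G)) (mtop (Arr G))) {(g, k). gtgt G g = gtgt G k}"
  have fst: "continuous_map ?P (mtop (Arr G)) fst" and snd: "continuous_map ?P (mtop (Arr G)) snd"
    by (auto intro: continuous_map_from_subtopology continuous_map_fst continuous_map_snd)
  have "continuous_map ?P (mtop (Arr G)) (\<lambda>z. ginv G (fst z))"
    using continuous_map_compose[OF fst continuous_inv] by (simp add: o_def)
  then have "continuous_map ?P (subtopology (prod_topology (mtop (Arr G)) (mtop (Arr G))) (composable G))
      (\<lambda>z. (ginv G (fst z), snd z))"
    using snd by (auto simp: continuous_map_in_subtopology continuous_map_pairedI composable_def
        inv_arrow arrows_def[symmetric])
  from continuous_map_compose[OF this continuous_comp]
  have "continuous_map ?P (mtop (Arr G)) (\<lambda>z. gcomp G (ginv G (fst z)) (snd z))"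
    by (simp add: o_def)
  then have "continuous_map ?P euclidean (\<lambda>z. coef s (snd z) * cnj (coef \<sigma> (gcomp G (ginv G (fst z)) (snd z))))"
    using continuous_map_compose[OF _ continuous_coef[OF \<sigma>]] continuous_map_compose[OF snd continuous_coef[OF s]]
    by (intro continuous_map_mult continuous_map_cnj) (auto simp: o_def)
  then have "continuous_map (mtop (Arr G)) euclidean
      (\<lambda>g. \<Sum>k\<in>fib (gtgt G g). coef s k * cnj (coef \<sigma> (gcomp G (ginv G g) k)))"
    by (intro tgt.continuous_map_fibre_sum continuous_tgt)
      (use fib_local in \<open>auto simp: case_prod_unfold fib_def coef_def arrows_def objects_def\<close>)
  then have mixed: "continuous_map (mtop (Arr G)) euclidean
      (\<lambda>g. hinner (E (gtgt G g)) (s (gtgt G g)) (translate g (\<sigma> (gsrc G g))))"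
  proof (rule continuous_map_eq)
    fix g assume "g \<in> topspace (mtop (Arr G))"
    then have g: "g \<in> arrows G" by (simp add: arrows_def)
    show "(\<Sum>k\<in>fib (gtgt G g). coef s k * cnj (coef \<sigma> (gcomp G (ginv G g) k))) =
        hinner (E (gtgt G g)) (s (gtgt G g)) (translate g (\<sigma> (gsrc G g)))"
      unfolding hinner_E
      by (intro sum.cong refl) (simp add: coef_fib coef_fib[OF inv_comp_fib[OF g]] translate_idx)
  qed
  have ss: "continuous_map (mtop (Arr G)) euclidean (\<lambda>g. hinner (E (gtgt G g)) (s (gtgt G g)) (s (gtgt G g)))"
    using continuous_map_compose[OF continuous_tgt continuous_hinner_sections[OF s s]] by (simp add: o_def)
  have \<sigma>\<sigma>: "continuous_map (mtop (Arr G)) euclidean (\<lambda>g. hinner (E (gsrc G g)) (\<sigma> (gsrc G g)) (\<sigma> (gsrc G g)))"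
    using continuous_map_compose[OF continuous_src continuous_hinner_sections[OF \<sigma> \<sigma>]] by (simp add: o_def)
  have "continuous_map (mtop (Arr G)) euclideanreal (\<lambda>g. sqrt (
      Re (hinner (E (gtgt G g)) (s (gtgt G g)) (s (gtgt G g))) +
      Re (hinner (E (gsrc G g)) (\<sigma> (gsrc G g)) (\<sigma> (gsrc G g))) -
      2 * Re (hinner (E (gtgt G g)) (s (gtgt G g)) (translate g (\<sigma> (gsrc G g))))))"
    by (intro continuous_map_sqrt continuous_map_diff continuous_map_add continuous_map_real_mult_left
        continuous_map_Re ss \<sigma>\<sigma> mixed)
  then show ?thesis
  proof (rule continuous_map_eq)
    fix g assume "g \<in> topspace (mtop (Arr G))"
    then have g: "g \<in> arrows G" by (simp add: arrows_def)
    show "sqrt (Re (hinner (E (gtgt G g)) (s (gtgt G g)) (s (gtgt G g))) +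
        Re (hinner (E (gsrc G g)) (\<sigma> (gsrc G g)) (\<sigma> (gsrc G g))) -
        2 * Re (hinner (E (gtgt G g)) (s (gtgt G g)) (translate g (\<sigma> (gsrc G g))))) =
      hnorm (E (gtgt G g)) (s (gtgt G g) \<ominus>\<^bsub>E (gtgt G g)\<^esub> translate g (\<sigma> (gsrc G g)))"
      by (subst hinner_translate[OF g, symmetric]) (simp only: E_def hnorm_l2_minus_eq)
  qed
qed

section \<open>The total space and continuity of the action\<close>

abbreviation total where
  "total \<equiv> total_topology (mtop (Obj G)) E sections"

lemma openin_tube:
  "\<lbrakk>openin (mtop (Obj G)) V; s \<in> sections; \<epsilon> > 0\<rbrakk> \<Longrightarrow> openin total (tube E V s \<epsilon>)"
  unfolding total_topology_def by (intro topology_generated_by_Basis) blast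

lemma topspace_total: "topspace total = {(x, v). x \<in> objects G \<and> v \<in> carrier (E x)}"
proof -
  have "\<exists>s\<in>sections. (x, v) \<in> tube E (objects G) s 1" if "x \<in> objects G" "v \<in> carrier (E x)" for x v
  proof -
    have "\<exists>s\<in>sections. s x = v" using that by (rule section_through)
    then obtain s where "s \<in> sections" "s x = v" by blast
    then show ?thesis using that by (intro bexI[of _ s]) (auto simp: tube_def E_def hnorm_l2_minus L2_set_def)
  qed
  moreover have "tube E (objects G) s 1 \<subseteq> topspace total" if "s \<in> sections" for s
    using that by (intro openin_subset openin_tube) (simp_all add: objects_def)
  ultimately have "{(x, v). x \<in> objects G \<and> v \<in> carrier (E x)} \<subseteq> topspace total"
    by blast
  moreover have "tube E V s \<epsilon> \<subseteq> {(x, v). x \<in> objects G \<and> v \<in> carrier (E x)}"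
    if "openin (mtop (Obj G)) V" for V s \<epsilon>
    using openin_subset[OF that] by (auto simp: tube_def objects_def)
  then have "topspace total \<subseteq> {(x, v). x \<in> objects G \<and> v \<in> carrier (E x)}"
    unfolding total_topology_def topology_generated_by_topspace by blast
  ultimately show ?thesis by (rule equalityI[rotated])
qed

text \<open>Take a section \<open>\<sigma>\<close> through \<open>v0\<close>; the distance
  \<open>r\<close> from \<open>s\<close> to the translate of \<open>\<sigma>\<close> is continuous
  in the arrow. Translation is isometric, so it sends vectors within \<open>\<delta>\<close> of
  \<open>\<sigma>\<close> to vectors within \<open>r g + \<delta>\<close> of
  \<open>s\<close>.\<close>

lemma openin_act_preimage_tube:
  defines "D \<equiv> subtopology (prod_topology (mtop (Arr G)) total) {(g, e). gsrc G g = fst e}"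
  assumes V: "openin (mtop (Obj G)) V" and s: "s \<in> sections"
  shows "openin D ((\<lambda>(g, e). act g e) -` tube E V s \<epsilon> \<inter> topspace D)"
proof (subst openin_subopen, intro ballI)
  fix p assume p: "p \<in> (\<lambda>(g, e). act g e) -` tube E V s \<epsilon> \<inter> topspace D"
  obtain g0 x0 v0 where p_eq: "p = (g0, x0, v0)" by (metis prod.exhaust)
  have g0: "g0 \<in> arrows G" and x0: "x0 = gsrc G g0" and v0: "v0 \<in> carrier (E x0)"
    using p by (auto simp: p_eq D_def topspace_total arrows_def)
  obtain \<sigma> where \<sigma>: "\<sigma> \<in> sections" "\<sigma> x0 = v0"
    using section_through[OF _ v0] g0 x0 src_closed by blast
  define r where
    "r g = hnorm (E (gtgt G g)) (s (gtgt G g) \<ominus>\<^bsub>E (gtgt G g)\<^esub> translate g (\<sigma> (gsrc G g)))" for g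
  have r0: "gtgt G g0 \<in> V" "r g0 < \<epsilon>"
    using p \<sigma> by (auto simp: p_eq act_def tube_def r_def x0)
  \<comment> \<open>The slack \<open>\<epsilon> - r g0\<close> is shared equally between the
    variation of \<open>r\<close> and the radius of the tube around \<open>\<sigma>\<close>.\<close>
  define \<delta> where "\<delta> = (\<epsilon> - r g0) / 2"
  have \<delta>: "\<delta> > 0" "r g0 < \<epsilon> - \<delta>" using r0 by (auto simp: \<delta>_def field_simps)
  define A where "A = {g \<in> topspace (mtop (Arr G)). r g \<in> {..<\<epsilon> - \<delta>}} \<inter> {g \<in> topspace (mtop (Arr G)). gtgt G g \<in> V}"
  have "openin (mtop (Arr G)) A"
    unfolding A_def
    using continuous_hnorm_translate_sections[OF s \<sigma>(1)] V continuous_tgt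
    by (intro openin_Int openin_continuous_map_preimage[of _ euclideanreal r]
        openin_continuous_map_preimage[of _ "mtop (Obj G)" "gtgt G"]) (auto simp: r_def[abs_def])
  moreover have "openin total (tube E (objects G) \<sigma> \<delta>)"
    using \<sigma>(1) \<delta>(1) by (intro openin_tube) (simp_all add: objects_def)
  ultimately have "openin D ((A \<times> tube E (objects G) \<sigma> \<delta>) \<inter> {(g, e). gsrc G g = fst e})"
    unfolding D_def by (intro openin_subtopology_Int) (simp add: openin_prod_Times_iff)
  moreover have "p \<in> (A \<times> tube E (objects G) \<sigma> \<delta>) \<inter> {(g, e). gsrc G g = fst e}"
    using g0 r0 \<delta> \<sigma>(2) v0 src_closed
    by (auto simp: p_eq A_def x0 tube_def arrows_def E_def hnorm_l2_minus L2_set_def)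
  moreover have "(g, x, v) \<in> (\<lambda>(g, e). act g e) -` tube E V s \<epsilon> \<inter> topspace D"
    if "(g, x, v) \<in> (A \<times> tube E (objects G) \<sigma> \<delta>) \<inter> {(g, e). gsrc G g = fst e}" for g x v
  proof -
    have g: "g \<in> arrows G" "r g < \<epsilon> - \<delta>" "gtgt G g \<in> V" and x: "x = gsrc G g"
      and v: "x \<in> objects G" "v \<in> carrier (E x)" "hnorm (E x) (\<sigma> x \<ominus>\<^bsub>E x\<^esub> v) < \<delta>"
      using that by (auto simp: A_def tube_def arrows_def)
    have "hnorm (E (gtgt G g)) (s (gtgt G g) \<ominus>\<^bsub>E (gtgt G g)\<^esub> translate g v) \<le>
        r g + hnorm (E (gtgt G g)) (translate g (\<sigma> x) \<ominus>\<^bsub>E (gtgt G g)\<^esub> translate g v)"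
      unfolding r_def x E_def by (rule hnorm_l2_minus_triangle)
    also have "\<dots> < \<epsilon>"
      using g v(3) by (simp add: hnorm_translate_minus x)
    finally show ?thesis
      using g x v translate_carrier by (simp add: act_def tube_def D_def topspace_total arrows_def)
  qed
  ultimately show "\<exists>T. openin D T \<and> p \<in> T \<and> T \<subseteq> (\<lambda>(g, e). act g e) -` tube E V s \<epsilon> \<inter> topspace D"
    by (intro exI[of _ "(A \<times> tube E (objects G) \<sigma> \<delta>) \<inter> {(g, e). gsrc G g = fst e}"]) auto
qed

lemma continuous_map_act:
  "continuous_map (subtopology (prod_topology (mtop (Arr G)) total) {(g, e). gsrc G g = fst e})
     total (\<lambda>(g, e). act g e)"
proof -
  define D where "D = subtopology (prod_topology (mtop (Arr G)) total) {(g, e). gsrc G g = fst e}"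
  have "(\<lambda>(g, e). act g e) ` topspace D \<subseteq> topspace total"
    using translate_carrier tgt_closed by (auto simp: D_def topspace_total act_def arrows_def)
  \<comment> \<open>For a generated topology it suffices that preimages of the generating tubes are
    open.\<close>
  then have "continuous_map D total (\<lambda>(g, e). act g e)"
    unfolding total_topology_def topology_generated_by_topspace
    by (intro continuous_on_generated_topo) (use openin_act_preimage_tube in \<open>auto simp: D_def\<close>)
  then show ?thesis by (simp add: D_def)
qed

section \<open>Assembly of the representation\<close>

lemma groupoid_representation: "groupoid_representation G E sections act"
proof (intro groupoid_representation.intro groupoid_representation_axioms.intro)
  show "groupoid G" by unfold_locales
  show "continuous_hilbert_family (mtop (Obj G)) E sections"
    using continuous_fd_hilbert_family by (rule continuous_fd_hilbert_family.axioms)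
  show "continuous_map (subtopology (prod_topology (mtop (Arr G)) total) {(g, e). gsrc G g = fst e})
      total (\<lambda>(g, e). act g e)"
    by (rule continuous_map_act)
  show "linear_iso (E (gsrc G g)) (E (gtgt G g)) (fibre_map G act g)" if "g \<in> arrows G" for g
    using unitary_map_translate[OF that] by (simp add: fibre_map_act unitary_map_def)
qed (auto simp: act_def unit_arrow translate_unit translate_comp composable_def comp_arrow)

lemma unitary_representation: "unitary_representation G E sections act"
  by (intro unitary_representation.intro unitary_representation_axioms.intro groupoid_representation)
    (simp add: fibre_map_act unitary_map_translate)

lemma faithful_representation: "faithful_representation G E sections act"
proof (intro faithful_representation.intro faithful_representation_axioms.intro groupoid_representation)
  fix x g h
  assume "g \<in> hom_arrows G x x" "h \<in> hom_arrows G x x"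
    and "\<And>v. v \<in> carrier (E x) \<Longrightarrow> act g (x, v) = act h (x, v)"
  then show "g = h"
    by (intro translate_faithful[of g x h]) (auto simp: act_def)
qed

end

theorem theorem4p1:
  fixes G :: "('o, 'a) groupoid_data"
  assumes "orbifold_groupoid G"
  shows "\<exists>(E :: 'o \<Rightarrow> (nat \<Rightarrow> complex) hilbert) \<Gamma> act.
           continuous_fd_hilbert_family (mtop (Obj G)) E \<Gamma> \<and>
           unitary_representation G E \<Gamma> act \<and>
           faithful_representation G E \<Gamma> act"
proof -
  interpret orbifold_groupoid G by fact
  obtain a :: "'a \<Rightarrow> real" where a: "continuous_map (mtop (Arr G)) euclideanreal a"
    "\<And>h g. (h, g) \<in> composable G \<Longrightarrow> a (gcomp G h g) = a g"
    "\<And>x. x \<in> objects G \<Longrightarrow> \<exists>g\<in>arrows G. gtgt G g = x \<and> a g \<noteq> 0"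
    "\<And>x. x \<in> objects G \<Longrightarrow> \<exists>V C. openin (mtop (Obj G)) V \<and> x \<in> V \<and> compactin (mtop (Arr G)) C \<and>
        {g \<in> arrows G. gtgt G g \<in> V \<and> a g \<noteq> 0} \<subseteq> C"
    by (rule exists_invariant_weight) (rule that)
  interpret weighted_orbifold_groupoid G a
    by unfold_locales (rule a; assumption)+
  show ?thesis
    using continuous_fd_hilbert_family unitary_representation faithful_representation by blast
qed

end
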